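(* Let $M$ be a connected complex manifold of dimension $\geq 1$ with a commutative and associative $\mathcal O_M$-bilinear multiplication $\circ$ on $TM$, a global unit field $e$, and a metric $g$ (a symmetric nondegenerate holomorphic bilinear form on $TM$) which is multiplication invariant, i.e. the $(3,0)$-tensor $A$ given by $A(X,Y,Z):=g(X,Y\circ Z)$ is symmetric in all three arguments. Let $\nabla$ be the Levi-Civita connection of $g$, and let $\varepsilon$ be the 1-form defined by $\varepsilon(X)=g(X,e)$. Then the following conditions are equivalent: (i) $(M,\circ,e)$ is an F-manifold and $\varepsilon$ is closed. (ii) The $(4,0)$-tensor $\nabla A$ is symmetric in all four arguments. (iii) The $(3,1)$-tensor $\nabla\circ$ is symmetric in all three arguments.
   Context: An F-manifold is a triple $(M,\circ,e)$ where $M$ is a connected complex manifold of dimension $\ge 1$, $\circ$ is a commutative and associative $\mathcal O_M$-bilinear multiplication on the holomorphic tangent sheaf $\mathcal T_M$, $e$ is a global unit field, and for any two local vector fields $X,Y$ $$\mathrm{Lie}_{X\circ Y}(\circ)=X\circ \mathrm{Lie}_Y(\circ)+Y\circ\mathrm{Lie}_X(\circ),$$ where $\mathrm{Lie}_X(\circ)(Z,W)=[X,Z\circ W]-[X,Z]\circ W-Z\circ[X,W]$. The tensors are $$\nabla\circ(X,Y,Z)=\nabla_X(Y\circ Z)-\nabla_X(Y)\circ Z-Y\circ\nabla_X(Z),$$ $$\nabla A(X,Y,Z,W)=X\big(A(Y,Z,W)\big)-A(\nabla_XY,Z,W)-A(Y,\nabla_XZ,W)-A(Y,Z,\nabla_XW).$$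 *)

theory Defs
  imports "HOL-Analysis.Analysis" "HOL-Library.Function_Algebras" "HOL-Combinatorics.Permutations"
begin

section \<open>Complex manifolds\<close>

text \<open>Intended for open sets \<open>S\<close>: complex differentiability (a complex-linear Frechet derivative)
  at every point of \<open>S\<close>.\<close>

definition mv_holomorphic_on :: "(complex^'n \<Rightarrow> complex) \<Rightarrow> (complex^'n) set \<Rightarrow> bool" where
  "mv_holomorphic_on f S \<longleftrightarrow>
     (\<forall>z\<in>S. \<exists>f'. (f has_derivative f') (at z) \<and> (\<forall>c v. f' (c *s v) = c * f' v))"

text \<open>A chart is a pair of its domain and its coordinate map; only the values of the coordinate map
  on the domain matter.\<close>

type_synonym ('m, 'n) chart = "'m set \<times> ('m \<Rightarrow> complex^'n)"

definition is_chart :: "('m::topological_space, 'n::finite) chart \<Rightarrow> bool" where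
  "is_chart c \<longleftrightarrow> (case c of (U, \<phi>) \<Rightarrow>
     open U \<and> open (\<phi> ` U) \<and> (\<exists>\<psi>. homeomorphism U (\<phi> ` U) \<phi> \<psi>))"

definition complex_atlas :: "('m::topological_space, 'n::finite) chart set \<Rightarrow> bool" where
  "complex_atlas \<A> \<longleftrightarrow>
     (\<forall>c\<in>\<A>. is_chart c) \<and> (\<Union>(U, \<phi>)\<in>\<A>. U) = UNIV \<and>
     (\<forall>(U, \<phi>)\<in>\<A>. \<forall>(V, \<psi>)\<in>\<A>. \<forall>i.
        mv_holomorphic_on (\<lambda>z. \<phi> (inv_into V \<psi> z) $ i) (\<psi> ` (U \<inter> V)))"

text \<open>The manifold is the whole type \<open>'m\<close>, with its complex structure given by a (not necessarily
  maximal) atlas; its dimension \<open>CARD('n)\<close> is automatically at least 1.\<close>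

definition connected_complex_manifold ::
  "('m::{t2_space, second_countable_topology}, 'n::finite) chart set \<Rightarrow> bool" where
  "connected_complex_manifold \<A> \<longleftrightarrow> complex_atlas \<A> \<and> connected (UNIV :: 'm set)"

text \<open>The sections of the structure sheaf over an open set \<open>U\<close>. As everywhere below, local sections
  are represented by total functions, whose values outside \<open>U\<close> are irrelevant.\<close>

definition holfuns :: "('m::topological_space, 'n::finite) chart set \<Rightarrow> 'm set \<Rightarrow> ('m \<Rightarrow> complex) set" where
  "holfuns \<A> U = {f. \<forall>(V, \<phi>)\<in>\<A>. mv_holomorphic_on (f \<circ> inv_into V \<phi>) (\<phi> ` (U \<inter> V))}"

definition hol_near :: "('m::topological_space, 'n::finite) chart set \<Rightarrow> 'm \<Rightarrow> ('m \<Rightarrow> complex) \<Rightarrow> bool" where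
  "hol_near \<A> p f \<longleftrightarrow> (\<exists>U. open U \<and> p \<in> U \<and> f \<in> holfuns \<A> U)"


section \<open>Holomorphic vector fields\<close>

text \<open>Holomorphic tangent vectors at \<open>p\<close> are the complex-linear derivations on germs of holomorphic
  functions at \<open>p\<close>. They are made total by the value 0 on functions not holomorphic near \<open>p\<close>, so
  that equality of tangent vectors is equality of functions.\<close>

type_synonym 'm tvec = "('m \<Rightarrow> complex) \<Rightarrow> complex"
type_synonym 'm vfield = "'m \<Rightarrow> 'm tvec"

definition tangent_space :: "('m::topological_space, 'n::finite) chart set \<Rightarrow> 'm \<Rightarrow> 'm tvec set" where
  "tangent_space \<A> p = {v.
     (\<forall>f. \<not> hol_near \<A> p f \<longrightarrow> v f = 0) \<and>
     (\<forall>f h. hol_near \<A> p f \<and> hol_near \<A> p h \<and> eventually (\<lambda>q. f q = h q) (nhds p) \<longrightarrow> v f = v h) \<and>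
     (\<forall>f h. hol_near \<A> p f \<and> hol_near \<A> p h \<longrightarrow> v (\<lambda>q. f q + h q) = v f + v h) \<and>
     (\<forall>c f. hol_near \<A> p f \<longrightarrow> v (\<lambda>q. c * f q) = c * v f) \<and>
     (\<forall>f h. hol_near \<A> p f \<and> hol_near \<A> p h \<longrightarrow> v (\<lambda>q. f q * h q) = f p * v h + h p * v f)}"

definition deriv_along :: "'m vfield \<Rightarrow> ('m \<Rightarrow> complex) \<Rightarrow> 'm \<Rightarrow> complex" where
  "deriv_along X f = (\<lambda>p. X p f)"

definition vfields :: "('m::topological_space, 'n::finite) chart set \<Rightarrow> 'm set \<Rightarrow> 'm vfield set" where
  "vfields \<A> U = {X. (\<forall>p\<in>U. X p \<in> tangent_space \<A> p) \<and>
     (\<forall>V f. open V \<and> V \<subseteq> U \<and> f \<in> holfuns \<A> V \<longrightarrow> deriv_along X f \<in> holfuns \<A> V)}"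

text \<open>Sums and differences of vector fields are the pointwise ones of \<^theory>\<open>HOL-Library.Function_Algebras\<close>.\<close>

definition fscale :: "('m \<Rightarrow> complex) \<Rightarrow> 'm vfield \<Rightarrow> 'm vfield" where
  "fscale f X = (\<lambda>p h. f p * X p h)"

definition eq_on :: "'m set \<Rightarrow> ('m \<Rightarrow> 'b) \<Rightarrow> ('m \<Rightarrow> 'b) \<Rightarrow> bool" where
  "eq_on U X Y \<longleftrightarrow> (\<forall>p\<in>U. X p = Y p)"

definition lie_bracket :: "('m::topological_space, 'n::finite) chart set \<Rightarrow> 'm vfield \<Rightarrow> 'm vfield \<Rightarrow> 'm vfield" where
  "lie_bracket \<A> X Y = (\<lambda>p f. if hol_near \<A> p f
     then X p (deriv_along Y f) - Y p (deriv_along X f) else 0)"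

text \<open>Symmetry of a tensor in all its \<open>k\<close> arguments, which are local vector fields \<open>X 0, \<dots>, X (k-1)\<close>
  on a common open set.\<close>

definition symmetric_tensor ::
  "('m::topological_space, 'n::finite) chart set \<Rightarrow> nat \<Rightarrow> ((nat \<Rightarrow> 'm vfield) \<Rightarrow> 'm \<Rightarrow> 'b) \<Rightarrow> bool" where
  "symmetric_tensor \<A> k T \<longleftrightarrow>
     (\<forall>U X \<pi>. open U \<and> (\<forall>i<k. X i \<in> vfields \<A> U) \<and> \<pi> permutes {..<k} \<longrightarrow>
        eq_on U (T (X \<circ> \<pi>)) (T X))"


section \<open>Multiplications and F-manifolds\<close>

text \<open>Operations on the tangent sheaf act on total representatives of local vector fields;
  \<open>local_operation\<close> says that such an operation defines a morphism of sheaves of sets from the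
  product of the tangent sheaf with itself to the tangent sheaf.\<close>

definition local_operation ::
  "('m::topological_space, 'n::finite) chart set \<Rightarrow> ('m vfield \<Rightarrow> 'm vfield \<Rightarrow> 'm vfield) \<Rightarrow> bool" where
  "local_operation \<A> m \<longleftrightarrow>
     (\<forall>U. open U \<longrightarrow> (\<forall>X\<in>vfields \<A> U. \<forall>Y\<in>vfields \<A> U.
        m X Y \<in> vfields \<A> U \<and>
        (\<forall>X'\<in>vfields \<A> U. \<forall>Y'\<in>vfields \<A> U.
           eq_on U X X' \<and> eq_on U Y Y' \<longrightarrow> eq_on U (m X Y) (m X' Y'))))"

definition O_bilinear ::
  "('m::topological_space, 'n::finite) chart set \<Rightarrow> ('m vfield \<Rightarrow> 'm vfield \<Rightarrow> 'm vfield) \<Rightarrow> bool" where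
  "O_bilinear \<A> m \<longleftrightarrow>
     (\<forall>U. open U \<longrightarrow> (\<forall>X\<in>vfields \<A> U. \<forall>Y\<in>vfields \<A> U. \<forall>Z\<in>vfields \<A> U. \<forall>f\<in>holfuns \<A> U.
        eq_on U (m (X + Y) Z) (m X Z + m Y Z) \<and>
        eq_on U (m X (Y + Z)) (m X Y + m X Z) \<and>
        eq_on U (m (fscale f X) Y) (fscale f (m X Y)) \<and>
        eq_on U (m X (fscale f Y)) (fscale f (m X Y))))"

definition tangent_multiplication ::
  "('m::topological_space, 'n::finite) chart set \<Rightarrow> ('m vfield \<Rightarrow> 'm vfield \<Rightarrow> 'm vfield) \<Rightarrow> bool" where
  "tangent_multiplication \<A> m \<longleftrightarrow> local_operation \<A> m \<and> O_bilinear \<A> m \<and>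
     (\<forall>U. open U \<longrightarrow> (\<forall>X\<in>vfields \<A> U. \<forall>Y\<in>vfields \<A> U. \<forall>Z\<in>vfields \<A> U.
        eq_on U (m X Y) (m Y X) \<and> eq_on U (m (m X Y) Z) (m X (m Y Z))))"

definition unit_field ::
  "('m::topological_space, 'n::finite) chart set \<Rightarrow> ('m vfield \<Rightarrow> 'm vfield \<Rightarrow> 'm vfield) \<Rightarrow> 'm vfield \<Rightarrow> bool" where
  "unit_field \<A> m e \<longleftrightarrow> e \<in> vfields \<A> UNIV \<and>
     (\<forall>U. open U \<longrightarrow> (\<forall>X\<in>vfields \<A> U. eq_on U (m e X) X))"

definition lie_mult ::
  "('m::topological_space, 'n::finite) chart set \<Rightarrow> ('m vfield \<Rightarrow> 'm vfield \<Rightarrow> 'm vfield) \<Rightarrow>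
     'm vfield \<Rightarrow> 'm vfield \<Rightarrow> 'm vfield \<Rightarrow> 'm vfield" where
  "lie_mult \<A> m X Z W =
     lie_bracket \<A> X (m Z W) - m (lie_bracket \<A> X Z) W - m Z (lie_bracket \<A> X W)"

definition F_manifold ::
  "('m::{t2_space, second_countable_topology}, 'n::finite) chart set \<Rightarrow>
     ('m vfield \<Rightarrow> 'm vfield \<Rightarrow> 'm vfield) \<Rightarrow> 'm vfield \<Rightarrow> bool" where
  "F_manifold \<A> m e \<longleftrightarrow>
     connected_complex_manifold \<A> \<and> tangent_multiplication \<A> m \<and> unit_field \<A> m e \<and>
     (\<forall>U. open U \<longrightarrow>
        (\<forall>X\<in>vfields \<A> U. \<forall>Y\<in>vfields \<A> U. \<forall>Z\<in>vfields \<A> U. \<forall>W\<in>vfields \<A> U.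
           eq_on U (lie_mult \<A> m (m X Y) Z W)
                   (m X (lie_mult \<A> m Y Z W) + m Y (lie_mult \<A> m X Z W))))"


section \<open>Metrics and the Levi-Civita connection\<close>

definition pair_fields :: "('m \<Rightarrow> 'm tvec \<Rightarrow> 'm tvec \<Rightarrow> complex) \<Rightarrow> 'm vfield \<Rightarrow> 'm vfield \<Rightarrow> 'm \<Rightarrow> complex" where
  "pair_fields g X Y = (\<lambda>p. g p (X p) (Y p))"

text \<open>A holomorphic metric is complex bilinear (not Hermitian) on each holomorphic tangent space.\<close>

definition hol_metric ::
  "('m::topological_space, 'n::finite) chart set \<Rightarrow> ('m \<Rightarrow> 'm tvec \<Rightarrow> 'm tvec \<Rightarrow> complex) \<Rightarrow> bool" where
  "hol_metric \<A> g \<longleftrightarrow>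
     (\<forall>p. \<forall>u\<in>tangent_space \<A> p. \<forall>v\<in>tangent_space \<A> p.
        (\<forall>w\<in>tangent_space \<A> p. g p (u + v) w = g p u w + g p v w) \<and>
        (\<forall>c. g p (\<lambda>f. c * u f) v = c * g p u v) \<and>
        g p u v = g p v u) \<and>
     (\<forall>p. \<forall>u\<in>tangent_space \<A> p. (\<forall>v\<in>tangent_space \<A> p. g p u v = 0) \<longrightarrow> u = 0) \<and>
     (\<forall>U. open U \<longrightarrow> (\<forall>X\<in>vfields \<A> U. \<forall>Y\<in>vfields \<A> U. pair_fields g X Y \<in> holfuns \<A> U))"

definition tensor_A ::
  "('m vfield \<Rightarrow> 'm vfield \<Rightarrow> 'm vfield) \<Rightarrow> ('m \<Rightarrow> 'm tvec \<Rightarrow> 'm tvec \<Rightarrow> complex) \<Rightarrow>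
     'm vfield \<Rightarrow> 'm vfield \<Rightarrow> 'm vfield \<Rightarrow> 'm \<Rightarrow> complex" where
  "tensor_A m g X Y Z = pair_fields g X (m Y Z)"

definition mult_invariant ::
  "('m::topological_space, 'n::finite) chart set \<Rightarrow> ('m vfield \<Rightarrow> 'm vfield \<Rightarrow> 'm vfield) \<Rightarrow>
     ('m \<Rightarrow> 'm tvec \<Rightarrow> 'm tvec \<Rightarrow> complex) \<Rightarrow> bool" where
  "mult_invariant \<A> m g \<longleftrightarrow> symmetric_tensor \<A> 3 (\<lambda>X. tensor_A m g (X 0) (X 1) (X 2))"

definition hol_connection ::
  "('m::topological_space, 'n::finite) chart set \<Rightarrow> ('m vfield \<Rightarrow> 'm vfield \<Rightarrow> 'm vfield) \<Rightarrow> bool" where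
  "hol_connection \<A> D \<longleftrightarrow> local_operation \<A> D \<and>
     (\<forall>U. open U \<longrightarrow> (\<forall>X\<in>vfields \<A> U. \<forall>Y\<in>vfields \<A> U. \<forall>Z\<in>vfields \<A> U. \<forall>f\<in>holfuns \<A> U.
        eq_on U (D (X + Y) Z) (D X Z + D Y Z) \<and>
        eq_on U (D (fscale f X) Y) (fscale f (D X Y)) \<and>
        eq_on U (D X (Y + Z)) (D X Y + D X Z) \<and>
        eq_on U (D X (fscale f Y)) (fscale (deriv_along X f) Y + fscale f (D X Y))))"

definition levi_civita ::
  "('m::topological_space, 'n::finite) chart set \<Rightarrow> ('m \<Rightarrow> 'm tvec \<Rightarrow> 'm tvec \<Rightarrow> complex) \<Rightarrow>
     ('m vfield \<Rightarrow> 'm vfield \<Rightarrow> 'm vfield) \<Rightarrow> bool" where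
  "levi_civita \<A> g D \<longleftrightarrow> hol_connection \<A> D \<and>
     (\<forall>U. open U \<longrightarrow> (\<forall>X\<in>vfields \<A> U. \<forall>Y\<in>vfields \<A> U. \<forall>Z\<in>vfields \<A> U.
        eq_on U (D X Y - D Y X) (lie_bracket \<A> X Y) \<and>
        eq_on U (deriv_along X (pair_fields g Y Z))
                (pair_fields g (D X Y) Z + pair_fields g Y (D X Z))))"

text \<open>1-forms act on local vector fields.\<close>

definition coidentity :: "('m \<Rightarrow> 'm tvec \<Rightarrow> 'm tvec \<Rightarrow> complex) \<Rightarrow> 'm vfield \<Rightarrow> 'm vfield \<Rightarrow> 'm \<Rightarrow> complex" where
  "coidentity g e X = pair_fields g X e"

definition ext_deriv ::
  "('m::topological_space, 'n::finite) chart set \<Rightarrow> ('m vfield \<Rightarrow> 'm \<Rightarrow> complex) \<Rightarrow>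
     'm vfield \<Rightarrow> 'm vfield \<Rightarrow> 'm \<Rightarrow> complex" where
  "ext_deriv \<A> \<omega> X Y = deriv_along X (\<omega> Y) - deriv_along Y (\<omega> X) - \<omega> (lie_bracket \<A> X Y)"

definition closed_form ::
  "('m::topological_space, 'n::finite) chart set \<Rightarrow> ('m vfield \<Rightarrow> 'm \<Rightarrow> complex) \<Rightarrow> bool" where
  "closed_form \<A> \<omega> \<longleftrightarrow>
     (\<forall>U. open U \<longrightarrow> (\<forall>X\<in>vfields \<A> U. \<forall>Y\<in>vfields \<A> U. eq_on U (ext_deriv \<A> \<omega> X Y) 0))"

definition nabla_mult ::
  "('m vfield \<Rightarrow> 'm vfield \<Rightarrow> 'm vfield) \<Rightarrow> ('m vfield \<Rightarrow> 'm vfield \<Rightarrow> 'm vfield) \<Rightarrow>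
     'm vfield \<Rightarrow> 'm vfield \<Rightarrow> 'm vfield \<Rightarrow> 'm vfield" where
  "nabla_mult D m X Y Z = D X (m Y Z) - m (D X Y) Z - m Y (D X Z)"

definition nabla_A ::
  "('m vfield \<Rightarrow> 'm vfield \<Rightarrow> 'm vfield) \<Rightarrow> ('m vfield \<Rightarrow> 'm vfield \<Rightarrow> 'm vfield) \<Rightarrow>
     ('m \<Rightarrow> 'm tvec \<Rightarrow> 'm tvec \<Rightarrow> complex) \<Rightarrow>
     'm vfield \<Rightarrow> 'm vfield \<Rightarrow> 'm vfield \<Rightarrow> 'm vfield \<Rightarrow> 'm \<Rightarrow> complex" where
  "nabla_A D m g X Y Z W =
     deriv_along X (tensor_A m g Y Z W) - tensor_A m g (D X Y) Z W
       - tensor_A m g Y (D X Z) W - tensor_A m g Y Z (D X W)"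

end

theory Submission
  imports Defs "HOL-Complex_Analysis.Cauchy_Integral_Formula"
begin

text \<open>
  Write \<open>T(X, Y, Z)\<close> for the tensor \<open>\<nabla>\<circ>\<close>; it is symmetric in \<open>Y\<close> and \<open>Z\<close>. Since \<open>g\<close> is parallel,
  \<open>\<nabla>A(X, Y, Z, W) = g(Y, T(X, Z, W))\<close> (lemma \<open>nabla_A_eq\<close>), and since \<open>A\<close> is symmetric, \<open>\<nabla>A\<close> is
  symmetric in its last three arguments. So (ii) and (iii) both say that the direction of
  differentiation can be exchanged with another argument, the former after pairing with an arbitrary
  vector field.

  (iii) implies (i). Since \<open>\<nabla>\<close> is torsion free, the difference of the two sides of the F-manifold
  identity can be written with \<open>T\<close> alone (\<open>F_defect_eq\<close>). For each direction \<open>V\<close> the map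
  \<open>T(V, \<sqdot>, \<sqdot>)\<close> is a Hochschild cocycle, being the coboundary of \<open>\<nabla>\<^sub>V\<close>, and two instances of the cocycle
  identity cancel all terms if \<open>T\<close> is totally symmetric (\<open>F_defect_eq_0\<close>). Moreover
  \<open>d\<epsilon>(X, Y) = g(Y, \<nabla>\<^sub>X e) - g(X, \<nabla>\<^sub>Y e)\<close>, and \<open>T(X, e, Y) = - \<nabla>\<^sub>X e \<circ> Y\<close>, so that \<open>d\<epsilon>\<close> vanishes.

  (i) implies (ii). Pairing the F-manifold identity with \<open>e\<close> turns it into a relation between values of
  \<open>\<nabla>A\<close>; the two terms with a product in the direction of differentiation cancel because \<open>d\<epsilon> = 0\<close>. If \<open>b(X)\<close> denotes
  \<open>\<nabla>A\<close> with direction \<open>X\<close> and the remaining three of the fields \<open>X, Y, Z, W\<close> as arguments, the relation is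
  \<open>b(X) + b(Y) = b(Z) + b(W)\<close>. It holds for every arrangement of the four fields, and hence all four
  values agree (\<open>B_cov_mult_eq\<close>).

  (ii) implies (iii). By nondegeneracy it suffices to pair with tangent vectors. As \<open>g\<close> is nondegenerate on
  the space of all derivations of germs at a point, every such derivation has to be extended to a
  local holomorphic vector field (\<open>tangent_vector_extends\<close>). It agrees with a constant-coefficient
  field in a chart by Hadamard's lemma, and that field is holomorphic because partial derivatives of holomorphic
  functions are holomorphic. Both facts follow from holomorphy of parameter integrals
  (\<open>mv_holomorphic_on_integral\<close>): the derivative is an integral by Cauchy's formula on a complex line, and the coefficients in
  Hadamard's lemma are integrals over a segment.
\<close>

section \<open>Holomorphic functions of several variables\<close>

lemma norm_complex_scale: "norm (c *s (v :: complex^'n)) = norm c * norm v"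
  by (simp add: norm_vec_def norm_mult L2_set_right_distrib)

lemma scaleR_eq_complex_scale: "r *\<^sub>R (v :: complex^'n) = complex_of_real r *s v"
  by (simp add: vec_eq_iff scaleR_conv_of_real[symmetric])

lemma bounded_linear_complex_scale: "bounded_linear (\<lambda>c. c *s (v :: complex^'n))"
  by (rule bounded_linear_intro[of _ "norm v"])
     (simp_all add: vec_eq_iff algebra_simps norm_complex_scale)

lemma mv_holomorphic_onD:
  assumes "mv_holomorphic_on f S" "z \<in> S"
  shows "(f has_derivative frechet_derivative f (at z)) (at z)"
    "frechet_derivative f (at z) (c *s v) = c * frechet_derivative f (at z) v"
proof -
  from assms obtain f' where f': "(f has_derivative f') (at z)" "\<And>c v. f' (c *s v) = c * f' v"
    unfolding mv_holomorphic_on_def by blast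
  with frechet_derivative_at[OF f'(1)] show "(f has_derivative frechet_derivative f (at z)) (at z)"
    "frechet_derivative f (at z) (c *s v) = c * frechet_derivative f (at z) v" by simp_all
qed

lemma mv_holomorphic_on_continuous: "mv_holomorphic_on f S \<Longrightarrow> continuous_on S f"
  by (meson continuous_at_imp_continuous_on has_derivative_continuous mv_holomorphic_onD(1))

lemma mv_holomorphic_on_line:
  assumes "mv_holomorphic_on f S" "z + c *s v \<in> S"
  shows "((\<lambda>c. f (z + c *s v)) has_field_derivative frechet_derivative f (at (z + c *s v)) v) (at c)"
proof -
  have "((\<lambda>c. z + c *s v) has_derivative (\<lambda>c. c *s v)) (at c)"
    by (auto intro!: derivative_eq_intros bounded_linear.has_derivative[OF bounded_linear_complex_scale])
  from has_derivative_compose[OF this mv_holomorphic_onD(1)[OF assms]] mv_holomorphic_onD(2)[OF assms]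
  show ?thesis
    by (simp add: has_field_derivative_def mult_commute_abs)
qed

text \<open>
  The bound follows from Cauchy's inequality for the second derivative along the complex line through
  \<open>z\<close> in direction \<open>v\<close>. What matters is that it depends on \<open>f\<close> only through \<open>M\<close>: it is uniform in
  families of functions with a common bound.
\<close>
lemma mv_holomorphic_remainder:
  fixes f :: "complex^'n \<Rightarrow> complex"
  assumes hol: "mv_holomorphic_on f (ball z (3 * r))" and "r > 0" 
    and M: "\<And>w. w \<in> ball z (3 * r) \<Longrightarrow> norm (f w) \<le> M"
    and v: "norm v \<le> r"
  shows "norm (f (z + v) - f z - frechet_derivative f (at z) v) \<le> 2 * M / r\<^sup>2 * (norm v)\<^sup>2"
proof (cases "v = 0")
  case True
  then show ?thesis
    using mv_holomorphic_onD(2)[OF hol, of z 0 0] \<open>r > 0\<close> by simp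
next
  case False
  \<comment> \<open>The radius up to which the line stays in the ball; as it is at least 3, discs of radius \<open>r / norm v\<close> around points of the closed unit disc fit in.\<close>
  define \<rho> where "\<rho> = 3 * r / norm v"
  define \<phi> where "\<phi> = (\<lambda>c. f (z + c *s v))"
  have mem: "z + c *s v \<in> ball z (3 * r)" if "norm c < \<rho>" for c
    using that False by (simp add: \<rho>_def dist_norm norm_complex_scale field_simps)
  have der: "(\<phi> has_field_derivative frechet_derivative f (at (z + c *s v)) v) (at c)" if "norm c < \<rho>" for c
    unfolding \<phi>_def by (rule mv_holomorphic_on_line[OF hol mem[OF that]])
  have h: "\<phi> holomorphic_on ball 0 \<rho>"
    by (rule holomorphic_onI) (metis der has_field_derivative_at_within field_differentiable_def mem_ball_0)
  have rho: "\<rho> \<ge> 3" "r / norm v > 0" "r / norm v \<ge> 1" "1 + r / norm v < \<rho>"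
    using v False \<open>r > 0\<close> by (simp_all add: \<rho>_def field_simps)
  have sub: "cball c (r / norm v) \<subseteq> ball 0 \<rho>" if "norm c \<le> 1" for c :: complex
  proof
    fix d assume "d \<in> cball c (r / norm v)"
    then show "d \<in> ball 0 \<rho>" using rho(4) that norm_triangle_ineq[of c "d - c"] by (simp add: dist_norm norm_minus_commute)
  qed
  have B: "norm ((deriv ^^ 2) \<phi> c) \<le> fact 2 * M / (r / norm v)^2" if "c \<in> cball 0 1" for c
  proof (rule Cauchy_inequality)
    show "\<phi> holomorphic_on ball c (r / norm v)" "continuous_on (cball c (r / norm v)) \<phi>"
      using sub[of c] that ball_subset_cball[of c "r / norm v"]
      by (auto intro!: holomorphic_on_subset[OF h] holomorphic_on_imp_continuous_on simp del: ball_subset_cball)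
    show "norm (\<phi> x) \<le> M" if x: "norm (c - x) = r / norm v" for x
    proof -
      have "x \<in> cball c (r / norm v)" using x by (simp add: dist_norm)
      then have "x \<in> ball 0 \<rho>" using sub[of c] \<open>c \<in> _\<close> by auto
      then show ?thesis unfolding \<phi>_def by (intro M mem) simp
    qed
  qed (use rho in simp)
  have "norm ((deriv ^^ 0) \<phi> 1 - (\<Sum>i\<le>1. (deriv ^^ i) \<phi> 0 * (1 - 0) ^ i / fact i))
     \<le> (fact 2 * M / (r / norm v)^2) * norm ((1::complex) - 0) ^ Suc 1 / fact 1"
  proof (rule complex_Taylor[where S = "cball 0 1" and f = "\<lambda>i. (deriv ^^ i) \<phi>"])
    fix c :: complex and i :: nat assume "c \<in> cball 0 1"
    then have "c \<in> ball 0 \<rho>" using rho by simp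
    then show "((deriv ^^ i) \<phi> has_field_derivative (deriv ^^ Suc i) \<phi> c) (at c within cball 0 1)"
      using has_field_derivative_at_within[OF holomorphic_derivI[OF holomorphic_higher_deriv[OF h open_ball, of i] open_ball]]
      by simp
  qed (use B in \<open>simp_all add: numeral_2_eq_2\<close>)
  moreover have "deriv \<phi> 0 = frechet_derivative f (at z) v"
    using der[of 0] rho by (intro DERIV_imp_deriv) simp
  ultimately show ?thesis
    by (simp add: \<phi>_def power_divide field_simps fact_numeral)
qed

lemma mv_holomorphic_onI:
  assumes "\<And>z. z \<in> S \<Longrightarrow> (f has_derivative f' z) (at z)" "\<And>z c v. z \<in> S \<Longrightarrow> f' z (c *s v) = c * f' z v"
  shows "mv_holomorphic_on f S"
  unfolding mv_holomorphic_on_def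
proof
  fix z assume "z \<in> S"
  then show "\<exists>f'. (f has_derivative f') (at z) \<and> (\<forall>c v. f' (c *s v) = c * f' v)"
    using assms by (intro exI[of _ "f' z"]) simp
qed

lemma mv_holomorphic_on_local:
  assumes "\<And>z. z \<in> S \<Longrightarrow> \<exists>T h. open T \<and> z \<in> T \<and> mv_holomorphic_on h T \<and> (\<forall>x\<in>T. h x = f x)"
  shows "mv_holomorphic_on f S"
  unfolding mv_holomorphic_on_def
proof
  fix z assume "z \<in> S"
  from assms[OF this] obtain T h
    where T: "open T" "z \<in> T" "mv_holomorphic_on h T" "\<And>x. x \<in> T \<Longrightarrow> h x = f x" by metis
  have "(f has_derivative frechet_derivative h (at z)) (at z)"
    by (rule has_derivative_transform_within_open[OF mv_holomorphic_onD(1)[OF T(3,2)] T(1,2,4)])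
  with mv_holomorphic_onD(2)[OF T(3,2)]
  show "\<exists>f'. (f has_derivative f') (at z) \<and> (\<forall>c v. f' (c *s v) = c * f' v)"
    by (intro exI[of _ "frechet_derivative h (at z)"]) simp
qed

lemma mv_holomorphic_on_subset: "mv_holomorphic_on f S \<Longrightarrow> T \<subseteq> S \<Longrightarrow> mv_holomorphic_on f T"
  unfolding mv_holomorphic_on_def by (rule ballI) (drule (1) subsetD, drule (1) bspec)

lemma mv_holomorphic_on_cong:
  "open S \<Longrightarrow> (\<And>x. x \<in> S \<Longrightarrow> f x = h x) \<Longrightarrow> mv_holomorphic_on f S \<Longrightarrow> mv_holomorphic_on h S"
  by (rule mv_holomorphic_on_local, rule exI[of _ S], rule exI[of _ f]) simp

lemma mv_holomorphic_on_const [simp]: "mv_holomorphic_on (\<lambda>z. c) S"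
  by (rule mv_holomorphic_onI[where f' = "\<lambda>_ _. 0"]) simp_all

lemma mv_holomorphic_on_component [simp]: "mv_holomorphic_on (\<lambda>z. z $ i) S"
  by (rule mv_holomorphic_onI[where f' = "\<lambda>_ v. v $ i"])
     (simp_all add: bounded_linear_imp_has_derivative bounded_linear_vec_nth)

lemma mv_holomorphic_on_add:
  assumes "mv_holomorphic_on f S" "mv_holomorphic_on h S"
  shows "mv_holomorphic_on (\<lambda>z. f z + h z) S"
proof (rule mv_holomorphic_onI)
  fix z assume z: "z \<in> S"
  show "((\<lambda>z. f z + h z) has_derivative
      (\<lambda>v. frechet_derivative f (at z) v + frechet_derivative h (at z) v)) (at z)"
    by (intro has_derivative_add assms[THEN mv_holomorphic_onD(1)] z)
qed (simp_all add: assms[THEN mv_holomorphic_onD(2)] algebra_simps)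

lemma mv_holomorphic_on_mult:
  assumes "mv_holomorphic_on f S" "mv_holomorphic_on h S"
  shows "mv_holomorphic_on (\<lambda>z. f z * h z) S"
proof (rule mv_holomorphic_onI)
  fix z assume z: "z \<in> S"
  show "((\<lambda>z. f z * h z) has_derivative
      (\<lambda>v. f z * frechet_derivative h (at z) v + frechet_derivative f (at z) v * h z)) (at z)"
    by (intro has_derivative_mult assms[THEN mv_holomorphic_onD(1)] z)
qed (simp_all add: assms[THEN mv_holomorphic_onD(2)] algebra_simps)

lemma mv_holomorphic_on_compose:
  fixes \<phi> :: "complex^'m::finite \<Rightarrow> complex^'n::finite"
  assumes \<phi>: "\<And>i. mv_holomorphic_on (\<lambda>z. \<phi> z $ i) S" and f: "mv_holomorphic_on f T" and "\<phi> ` S \<subseteq> T"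
  shows "mv_holomorphic_on (\<lambda>z. f (\<phi> z)) S"
proof (rule mv_holomorphic_onI)
  fix z assume z: "z \<in> S"
  let ?\<phi>' = "\<lambda>v. \<Sum>i\<in>UNIV. frechet_derivative (\<lambda>z. \<phi> z $ i) (at z) v *s axis i 1"
  have "((\<lambda>z. \<Sum>i\<in>UNIV. (\<phi> z $ i) *s axis i 1) has_derivative ?\<phi>') (at z)"
    by (intro has_derivative_sum bounded_linear.has_derivative[OF bounded_linear_complex_scale]
        mv_holomorphic_onD(1)[OF \<phi> z])
  then have \<phi>': "(\<phi> has_derivative ?\<phi>') (at z)"
    by (simp add: basis_expansion)
  have f': "\<phi> z \<in> T" using z assms by blast
  show "((\<lambda>z. f (\<phi> z)) has_derivative (\<lambda>v. frechet_derivative f (at (\<phi> z)) (?\<phi>' v))) (at z)"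
    by (rule has_derivative_compose[OF \<phi>' mv_holomorphic_onD(1)[OF f f']])
  fix c v
  have "?\<phi>' (c *s v) = c *s ?\<phi>' v"
    by (simp add: mv_holomorphic_onD(2)[OF \<phi> z] vec_eq_iff sum_distrib_left mult.assoc)
  then show "frechet_derivative f (at (\<phi> z)) (?\<phi>' (c *s v)) = c * frechet_derivative f (at (\<phi> z)) (?\<phi>' v)"
    using mv_holomorphic_onD(2)[OF f f'] by simp
qed

text \<open>
  Holomorphy is mere complex differentiability at each point, so the derivatives of the integrands are
  not known to be jointly continuous, as the usual Leibniz rule would require. Instead the uniform quadratic remainder
  of \<open>mv_holomorphic_remainder\<close> is integrated.
\<close>
lemma mv_holomorphic_on_integral:
  fixes G :: "complex^'n \<Rightarrow> real \<Rightarrow> complex"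
  assumes S: "open S" and cont: "continuous_on (S \<times> {0..1}) (\<lambda>(z, t). G z t)"
    and hol: "\<And>t. t \<in> {0..1} \<Longrightarrow> mv_holomorphic_on (\<lambda>z. G z t) S"
  shows "mv_holomorphic_on (\<lambda>z. integral {0..1} (G z)) S"
  unfolding mv_holomorphic_on_def
proof
  fix z assume z: "z \<in> S"
  obtain r where r: "r > 0" "cball z (3 * r) \<subseteq> S"
  proof -
    obtain d where "d > 0" "cball z d \<subseteq> S" using S z open_contains_cball by blast
    with that[of "d / 3"] show ?thesis by simp
  qed
  define K where "K = cball z (3 * r) \<times> {0..1::real}"
  have "compact K" "continuous_on K (\<lambda>(z, t). G z t)"
    using continuous_on_subset[OF cont, of K] r by (auto simp: K_def intro!: compact_Times)
  then have "bounded ((\<lambda>(z, t). G z t) ` K)"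
    by (intro compact_imp_bounded compact_continuous_image)
  then obtain M where "\<forall>x\<in>K. norm (case x of (w, t) \<Rightarrow> G w t) \<le> M"
    unfolding bounded_iff by blast
  then have M: "norm (G w t) \<le> M" if "w \<in> cball z (3 * r)" "t \<in> {0..1}" for w t
    using that unfolding K_def by fastforce
  define C where "C = 2 * M / r\<^sup>2"
  define L where "L = (\<lambda>t v. frechet_derivative (\<lambda>z. G z t) (at z) v)"
  have rem: "norm (G (z + v) t - G z t - L t v) \<le> C * (norm v)\<^sup>2" if "norm v \<le> r" "t \<in> {0..1}" for v t
    unfolding L_def C_def
  proof (rule mv_holomorphic_remainder)
    show "mv_holomorphic_on (\<lambda>z. G z t) (ball z (3 * r))"
      using hol[OF that(2)] r(2) ball_subset_cball by (rule_tac mv_holomorphic_on_subset) auto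
  qed (use that r M in auto)
  have contG: "continuous_on {0..1} (G w)" if "w \<in> S" for w
  proof -
    have "continuous_on {0..1} (\<lambda>t. (\<lambda>(z, t). G z t) (w, t))"
      by (rule continuous_on_compose2[OF cont]) (use that in \<open>auto intro!: continuous_on_Pair continuous_on_const continuous_on_id\<close>)
    then show ?thesis by simp
  qed
  have zv: "z + v \<in> S" if "norm v \<le> r" for v
    using that r by (auto simp: dist_norm subset_iff)
  have L_lin: "L t (u + v) = L t u + L t v" and L_scale: "L t (c *s v) = c * L t v" if "t \<in> {0..1}" for t u v c
    using linear_add[OF has_derivative_linear[OF mv_holomorphic_onD(1)[OF hol[OF that] z]]]
      mv_holomorphic_onD(2)[OF hol[OF that] z] by (auto simp: L_def)
  \<comment> \<open>The derivative in a fixed direction is a uniform limit of difference quotients, hence continuous in the parameter.\<close>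
  have contL: "continuous_on {0..1} (\<lambda>t. L t v)" for v
  proof (rule uniform_limit_theorem)
    define s where "s = (\<lambda>n. inverse (real (Suc n)))"
    define h where "h = (\<lambda>n t. of_nat (Suc n) * (G (z + of_real (s n) *s v) t - G z t))"
    have s: "s \<longlonglongrightarrow> 0" "s n > 0" "of_nat (Suc n) * complex_of_real (s n) = 1" for n
      using LIMSEQ_inverse_real_of_nat by (simp_all add: s_def field_simps del: of_nat_Suc)
    have small: "\<forall>\<^sub>F n in sequentially. norm (of_real (s n) *s v) \<le> r"
    proof -
      have "(\<lambda>n. s n * norm v) \<longlonglongrightarrow> 0 * norm v" by (intro tendsto_intros s)
      then have "\<forall>\<^sub>F n in sequentially. s n * norm v < r" using r by (auto dest: order_tendstoD)
      then show ?thesis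
      proof eventually_elim
        case (elim n)
        then show ?case using s(2)[of n] by (simp add: norm_complex_scale)
      qed
    qed
    show "\<forall>\<^sub>F n in sequentially. continuous_on {0..1} (h n)"
      using small by eventually_elim (auto simp: h_def intro!: continuous_intros contG zv z)
    show "uniform_limit {0..1} h (\<lambda>t. L t v) sequentially"
    proof (rule uniform_limitI)
      fix \<epsilon> :: real assume "\<epsilon> > 0"
      have "(\<lambda>n. s n * (C * (norm v)\<^sup>2)) \<longlonglongrightarrow> 0 * (C * (norm v)\<^sup>2)" by (intro tendsto_intros s)
      then have "\<forall>\<^sub>F n in sequentially. s n * (C * (norm v)\<^sup>2) < \<epsilon>"
        using \<open>\<epsilon> > 0\<close> by (auto dest: order_tendstoD)
      with small show "\<forall>\<^sub>F n in sequentially. \<forall>t\<in>{0..1}. dist (h n t) (L t v) < \<epsilon>"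
      proof eventually_elim
        case (elim n)
        show ?case
        proof
          fix t :: real assume t: "t \<in> {0..1}"
          have "h n t - L t v = of_nat (Suc n) * (G (z + of_real (s n) *s v) t - G z t - L t (of_real (s n) *s v))"
            unfolding L_scale[OF t] h_def right_diff_distrib mult.assoc[symmetric] s(3) by simp
          then have "norm (h n t - L t v) \<le> real (Suc n) * (C * (norm (of_real (s n) *s v))\<^sup>2)"
            using rem[OF elim(1) t] by (simp add: norm_mult del: of_nat_Suc)
          also have "\<dots> = (real (Suc n) * s n) * (s n * (C * (norm v)\<^sup>2))"
            using s(2)[of n] by (simp add: norm_complex_scale power2_eq_square mult_ac del: of_nat_Suc)
          also have "real (Suc n) * s n = 1" by (simp add: s_def del: of_nat_Suc)
          finally show "dist (h n t) (L t v) < \<epsilon>" using elim(2) by (simp add: dist_norm)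
        qed
      qed
    qed
  qed simp
  define I where "I = (\<lambda>v. integral {0..1} (\<lambda>t. L t v))"
  have I_scale: "I (c *s v) = c * I v" for c v
  proof -
    have "I (c *s v) = integral {0..1} (\<lambda>t. c * L t v)"
      unfolding I_def using L_scale by (intro integral_cong) auto
    then show ?thesis by (simp add: I_def)
  qed
  have "linear I"
  proof (rule linearI)
    show "I (u + v) = I u + I v" for u v
    proof -
      have "I (u + v) = integral {0..1} (\<lambda>t. L t u + L t v)"
        unfolding I_def using L_lin by (intro integral_cong) auto
      also have "\<dots> = I u + I v"
        unfolding I_def by (intro integral_add integrable_continuous_real contL)
      finally show ?thesis .
    qed
  qed (simp add: scaleR_eq_complex_scale I_scale scaleR_conv_of_real)
  have "((\<lambda>z. integral {0..1} (G z)) has_derivative I) (at z)"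
    unfolding has_derivative_at
  proof
    show "bounded_linear I" using \<open>linear I\<close> linear_conv_bounded_linear by blast
    show "(\<lambda>v. norm (integral {0..1} (G (z + v)) - integral {0..1} (G z) - I v) / norm v) \<midarrow>0\<rightarrow> 0"
    proof (rule Lim_null_comparison)
      have "\<forall>\<^sub>F v in at 0. norm (v :: complex^'n) < r"
        using r eventually_at[of "\<lambda>v. norm v < r"] by fastforce
      then show "\<forall>\<^sub>F v in at 0. norm (norm (integral {0..1} (G (z + v)) - integral {0..1} (G z) - I v) / norm v)
          \<le> C * norm v"
      proof eventually_elim
        case (elim v)
        then have v: "norm v \<le> r" by simp
        have cont: "continuous_on {0..1} (G (z + v))" "continuous_on {0..1} (G z)"
          using contG z zv[OF v] by auto
        have "integral {0..1} (G (z + v)) - integral {0..1} (G z) - I v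
          = integral {0..1} (\<lambda>t. G (z + v) t - G z t - L t v)"
          unfolding I_def using cont contL
          by (simp add: integral_diff integrable_continuous_real integrable_diff)
        also have "norm \<dots> \<le> C * (norm v)\<^sup>2 * (1 - 0)"
          using rem[OF v] by (intro integral_bound continuous_intros cont contL) auto
        finally show ?case
          by (cases "v = 0") (simp_all add: power2_eq_square field_simps)
      qed
      show "((\<lambda>v :: complex^'n. C * norm v) \<longlongrightarrow> 0) (at 0)"
        by (auto intro!: tendsto_eq_intros)
    qed
  qed
  with I_scale show "\<exists>f'. ((\<lambda>z. integral {0..1} (G z)) has_derivative f') (at z) \<and> (\<forall>c v. f' (c *s v) = c * f' v)"
    by blast
qed

text \<open>
  Cauchy's formula on the complex line in direction \<open>w\<close> expresses the derivative at \<open>z\<close> as an integral over a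
  circle whose radius is the same for all \<open>z\<close> near a given point. The integrand is holomorphic in \<open>z\<close>.
\<close>
lemma mv_holomorphic_on_frechet_derivative:
  fixes f :: "complex^'n \<Rightarrow> complex"
  assumes "open S" and hol: "mv_holomorphic_on f S"
  shows "mv_holomorphic_on (\<lambda>z. frechet_derivative f (at z) w) S"
proof (rule mv_holomorphic_on_local)
  fix a assume "a \<in> S"
  then obtain r where r: "r > 0" "ball a (2 * r) \<subseteq> S"
  proof -
    obtain d where "d > 0" "ball a d \<subseteq> S" using assms(1) \<open>a \<in> S\<close> open_contains_ball by blast
    with that[of "d / 2"] show ?thesis by simp
  qed
  \<comment> \<open>Adding 1 only serves to allow \<open>w = 0\<close>.\<close>
  define s where "s = r / (norm w + 1)"
  have s: "s > 0" "s * norm w \<le> r"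
    using r by (simp_all add: s_def field_simps add_pos_nonneg)
  define \<gamma> where "\<gamma> = circlepath 0 s"
  have \<gamma>: "norm (\<gamma> t) = s" for t
    using s by (simp add: \<gamma>_def circlepath_def part_circlepath_def norm_mult)
  then have \<gamma>_nz: "\<gamma> t \<noteq> 0" for t
    using s(1) by (metis norm_zero less_irrefl)
  have cont_\<gamma>: "continuous_on A \<gamma>" for A
    unfolding \<gamma>_def circlepath_def part_circlepath_def linepath_def by (intro continuous_intros)
  have cont_\<gamma>': "continuous_on A (\<lambda>t. vector_derivative \<gamma> (at t))" for A
    unfolding \<gamma>_def circlepath_def vector_derivative_part_circlepath linepath_def by (intro continuous_intros)
  define k where "k = (\<lambda>t. vector_derivative \<gamma> (at t) / (\<gamma> t)\<^sup>2 / (2 * pi * \<i>))"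
  have mem: "z + c *s w \<in> S" if "z \<in> ball a r" "norm c \<le> s" for z c
  proof -
    have "norm c * norm w \<le> r" using s that by (meson mult_right_mono norm_ge_zero order_trans)
    then have "z + c *s w \<in> ball a (2 * r)"
      using that norm_triangle_ineq4[of "a - z" "c *s w"] by (simp add: dist_norm norm_complex_scale diff_diff_eq)
    then show ?thesis using r by blast
  qed
  let ?h = "\<lambda>z. integral {0..1} (\<lambda>t. f (z + \<gamma> t *s w) * k t)"
  have "mv_holomorphic_on ?h (ball a r)"
  proof (rule mv_holomorphic_on_integral)
    have "continuous_on (ball a r \<times> {0..1}) (\<lambda>x. fst x + \<gamma> (snd x) *s w)"
      by (intro continuous_intros bounded_linear.continuous_on[OF bounded_linear_complex_scale]
          continuous_on_compose2[OF cont_\<gamma>[of UNIV]]) auto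
    then have "continuous_on (ball a r \<times> {0..1}) (\<lambda>x. f (fst x + \<gamma> (snd x) *s w))"
      by (rule continuous_on_compose2[OF mv_holomorphic_on_continuous[OF hol]]) (auto intro!: mem simp: \<gamma>)
    moreover have "continuous_on UNIV k"
      unfolding k_def using \<gamma>_nz by (intro continuous_intros cont_\<gamma> cont_\<gamma>') simp_all
    then have "continuous_on (ball a r \<times> {0..1::real}) (\<lambda>x. k (snd x))"
      by (rule continuous_on_compose2) (auto intro!: continuous_intros)
    ultimately show "continuous_on (ball a r \<times> {0..1}) (\<lambda>(z, t). f (z + \<gamma> t *s w) * k t)"
      by (simp add: case_prod_unfold continuous_on_mult)
    show "mv_holomorphic_on (\<lambda>z. f (z + \<gamma> t *s w) * k t) (ball a r)" for t
      by (intro mv_holomorphic_on_mult mv_holomorphic_on_compose[OF _ hol])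
         (auto intro!: mv_holomorphic_on_add mem simp: \<gamma>)
  qed simp
  moreover have "?h z = frechet_derivative f (at z) w" if z: "z \<in> ball a r" for z
  proof -
    let ?\<phi> = "\<lambda>c. f (z + c *s w)"
    have der: "(?\<phi> has_field_derivative frechet_derivative f (at (z + c *s w)) w) (at c)" if "norm c \<le> s" for c
      by (rule mv_holomorphic_on_line[OF hol mem[OF z that]])
    have "frechet_derivative f (at z) w = deriv ?\<phi> 0"
      using der[of 0] s by (simp add: DERIV_imp_deriv)
    also have "\<dots> = contour_integral \<gamma> (\<lambda>u. ?\<phi> u / (u - 0)\<^sup>2) / (2 * pi * \<i>)"
    proof -
      have "continuous_on (cball 0 s) ?\<phi>"
        using der by (intro continuous_at_imp_continuous_on ballI) (auto dest: DERIV_isCont)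
      moreover have "?\<phi> holomorphic_on ball 0 s"
      proof (rule holomorphic_onI)
        fix c :: complex assume "c \<in> ball 0 s"
        then show "?\<phi> field_differentiable at c within ball 0 s"
          using has_field_derivative_at_within[OF der[of c]] by (auto simp only: field_differentiable_def mem_ball_0 less_imp_le)
      qed
      ultimately show ?thesis
        using Cauchy_contour_integral_circlepath_2[of 0 s ?\<phi> 0] s by (simp add: \<gamma>_def)
    qed
    also have "\<dots> = ?h z"
      unfolding contour_integral_integral k_def by (simp add: integral_divide[symmetric] field_simps)
    finally show ?thesis ..
  qed
  ultimately show "\<exists>T h. open T \<and> a \<in> T \<and> mv_holomorphic_on h T \<and>
      (\<forall>x\<in>T. h x = frechet_derivative f (at x) w)"
    using r by (intro exI[of _ "ball a r"] exI[of _ ?h]) simp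
qed

lemma frechet_derivative_expansion:
  fixes f :: "complex^'n \<Rightarrow> complex"
  assumes "mv_holomorphic_on f S" "z \<in> S"
  shows "frechet_derivative f (at z) v = (\<Sum>i\<in>UNIV. v $ i * frechet_derivative f (at z) (axis i 1))"
proof -
  have "linear (frechet_derivative f (at z))"
    using has_derivative_linear mv_holomorphic_onD(1)[OF assms] by blast
  then have "frechet_derivative f (at z) (\<Sum>i\<in>UNIV. v $ i *s axis i 1)
      = (\<Sum>i\<in>UNIV. v $ i * frechet_derivative f (at z) (axis i 1))"
    by (simp add: linear_sum mv_holomorphic_onD(2)[OF assms])
  then show ?thesis by (simp add: basis_expansion)
qed

text \<open>
  Hadamard's lemma: integrate the derivative of \<open>f\<close> along the segment from \<open>a\<close> to \<open>z\<close>.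
\<close>
lemma hadamard_mv_holomorphic:
  fixes f :: "complex^'n \<Rightarrow> complex"
  assumes hol: "mv_holomorphic_on f (ball a r)" and "r > 0"
  obtains H where "\<And>i. mv_holomorphic_on (H i) (ball a r)"
    "\<And>z. z \<in> ball a r \<Longrightarrow> f z = f a + (\<Sum>i\<in>UNIV. (z $ i - a $ i) * H i z)"
    "\<And>i. H i a = frechet_derivative f (at a) (axis i 1)"
proof -
  note vector_ssub_ldistrib [simp del]
  define d where "d = (\<lambda>i z. frechet_derivative f (at z) (axis i 1))"
  define H where "H = (\<lambda>i z. integral {0..1} (\<lambda>t. d i (a + of_real t *s (z - a))))"
  have d: "mv_holomorphic_on (d i) (ball a r)" for i
    unfolding d_def by (rule mv_holomorphic_on_frechet_derivative[OF open_ball hol])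
  have mem: "a + of_real t *s (z - a) \<in> ball a r" if "z \<in> ball a r" "t \<in> {0..1}" for z t
  proof -
    have "t * norm (z - a) \<le> 1 * norm (z - a)" using that by (intro mult_right_mono) auto
    moreover have "dist a (a + x) = norm x" for x by (simp add: dist_norm)
    then have "dist a (a + of_real t *s (z - a)) = norm (complex_of_real t) * norm (z - a)"
      by (simp only: norm_complex_scale)
    then have "dist a (a + of_real t *s (z - a)) = t * norm (z - a)"
      using that by simp
    ultimately show ?thesis
      using that by (simp only: mem_ball dist_norm norm_minus_commute)
  qed
  have cont_line: "continuous_on A (\<lambda>t. a + of_real t *s (z - a))" for A z
    by (intro continuous_intros bounded_linear.continuous_on[OF bounded_linear_complex_scale])
  have cont: "continuous_on {0..1} (\<lambda>t. d i (a + of_real t *s (z - a)))" if "z \<in> ball a r" for i z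
    by (rule continuous_on_compose2[OF mv_holomorphic_on_continuous[OF d] cont_line]) (use mem that in auto)
  show ?thesis
  proof
    fix i
    show "mv_holomorphic_on (H i) (ball a r)"
      unfolding H_def
    proof (rule mv_holomorphic_on_integral)
      have "continuous_on (ball a r \<times> {0..1}) (\<lambda>x. a + of_real (snd x) *s (fst x - a))"
        unfolding scaleR_eq_complex_scale[symmetric] by (intro continuous_intros)
      then have "continuous_on (ball a r \<times> {0..1}) (\<lambda>x. d i (a + of_real (snd x) *s (fst x - a)))"
        by (rule continuous_on_compose2[OF mv_holomorphic_on_continuous[OF d]]) (auto intro!: mem)
      then show "continuous_on (ball a r \<times> {0..1}) (\<lambda>(z, t). d i (a + of_real t *s (z - a)))"
        by (simp add: case_prod_unfold)
      have 1: "mv_holomorphic_on (\<lambda>z. - (a $ j) + z $ j) (ball a r)" for j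
        by (intro mv_holomorphic_on_add mv_holomorphic_on_const mv_holomorphic_on_component)
      show "mv_holomorphic_on (\<lambda>z. d i (a + of_real t *s (z - a))) (ball a r)" if "t \<in> {0..1}" for t
        by (rule mv_holomorphic_on_compose[OF _ d])
           (use 1 mem that in \<open>auto intro!: mv_holomorphic_on_add mv_holomorphic_on_mult\<close>)
    qed simp
    show "H i a = frechet_derivative f (at a) (axis i 1)"
      by (simp add: H_def d_def)
  next
    fix z assume z: "z \<in> ball a r"
    let ?\<phi> = "\<lambda>t. f (a + of_real t *s (z - a))"
    have der: "(?\<phi> has_vector_derivative (\<Sum>i\<in>UNIV. (z $ i - a $ i) * d i (a + of_real t *s (z - a))))
        (at t within {0..1})" if t: "t \<in> {0..1}" for t
      using has_vector_derivative_real_field[OF mv_holomorphic_on_line[OF hol mem[OF z t]]]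
      by (simp add: frechet_derivative_expansion[OF hol mem[OF z t], of "z - a"] d_def)
    have "((\<lambda>t. \<Sum>i\<in>UNIV. (z $ i - a $ i) * d i (a + of_real t *s (z - a))) has_integral ?\<phi> 1 - ?\<phi> 0) {0..1}"
      using der by (intro fundamental_theorem_of_calculus) auto
    moreover have "((\<lambda>t. \<Sum>i\<in>UNIV. (z $ i - a $ i) * d i (a + of_real t *s (z - a)))
        has_integral (\<Sum>i\<in>UNIV. (z $ i - a $ i) * H i z)) {0..1}"
      unfolding H_def
      by (intro has_integral_sum has_integral_mult_right integrable_integral integrable_continuous_real cont z) simp
    ultimately have "?\<phi> 1 - ?\<phi> 0 = (\<Sum>i\<in>UNIV. (z $ i - a $ i) * H i z)"
      by (rule has_integral_unique)
    then show "f z = f a + (\<Sum>i\<in>UNIV. (z $ i - a $ i) * H i z)"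
      by (simp add: algebra_simps)
  qed
qed

section \<open>Tangent vectors and holomorphic vector fields\<close>

lemma holfunsI:
  "(\<And>V \<phi>. (V, \<phi>) \<in> \<A> \<Longrightarrow> mv_holomorphic_on (\<lambda>z. f (inv_into V \<phi> z)) (\<phi> ` (U \<inter> V))) \<Longrightarrow> f \<in> holfuns \<A> U"
  by (simp add: holfuns_def o_def split_paired_all)

lemma holfunsD:
  "f \<in> holfuns \<A> U \<Longrightarrow> (V, \<phi>) \<in> \<A> \<Longrightarrow> mv_holomorphic_on (\<lambda>z. f (inv_into V \<phi> z)) (\<phi> ` (U \<inter> V))"
  unfolding holfuns_def o_def mem_Collect_eq by (drule (1) bspec) simp

lemma holfuns_subset: "f \<in> holfuns \<A> U \<Longrightarrow> V \<subseteq> U \<Longrightarrow> f \<in> holfuns \<A> V"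
  by (rule holfunsI, drule (1) holfunsD, erule mv_holomorphic_on_subset) blast

lemma holfuns_const: "(\<lambda>q. c) \<in> holfuns \<A> U"
  by (rule holfunsI) simp

lemma holfuns_add: "f \<in> holfuns \<A> U \<Longrightarrow> h \<in> holfuns \<A> U \<Longrightarrow> (\<lambda>q. f q + h q) \<in> holfuns \<A> U"
  by (rule holfunsI, rule mv_holomorphic_on_add) (erule (1) holfunsD)+

lemma holfuns_mult: "f \<in> holfuns \<A> U \<Longrightarrow> h \<in> holfuns \<A> U \<Longrightarrow> (\<lambda>q. f q * h q) \<in> holfuns \<A> U"
  by (rule holfunsI, rule mv_holomorphic_on_mult) (erule (1) holfunsD)+

lemma hol_near_common:
  assumes "hol_near \<A> p f" "hol_near \<A> p h"
  obtains U where "open U" "p \<in> U" "f \<in> holfuns \<A> U" "h \<in> holfuns \<A> U"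
proof -
  obtain U V where "open U" "p \<in> U" "f \<in> holfuns \<A> U" "open V" "p \<in> V" "h \<in> holfuns \<A> V"
    using assms unfolding hol_near_def by (elim exE conjE)
  then show ?thesis
    using that[of "U \<inter> V"] by (simp add: open_Int holfuns_subset)
qed

lemma hol_near_add: "hol_near \<A> p f \<Longrightarrow> hol_near \<A> p h \<Longrightarrow> hol_near \<A> p (\<lambda>q. f q + h q)"
  by (erule (1) hol_near_common) (unfold hol_near_def, intro exI conjI holfuns_add)

lemma hol_near_mult: "hol_near \<A> p f \<Longrightarrow> hol_near \<A> p h \<Longrightarrow> hol_near \<A> p (\<lambda>q. f q * h q)"
  by (erule (1) hol_near_common) (unfold hol_near_def, intro exI conjI holfuns_mult)

lemma hol_near_const: "hol_near \<A> p (\<lambda>q. c)"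
  unfolding hol_near_def by (intro exI[of _ UNIV]) (simp add: holfuns_const)

lemma hol_near_sum: "(\<And>i. i \<in> I \<Longrightarrow> hol_near \<A> p (f i)) \<Longrightarrow> hol_near \<A> p (\<lambda>q. \<Sum>i\<in>I. f i q)"
  by (induction I rule: infinite_finite_induct) (simp_all add: hol_near_const hol_near_add)

lemma tangent_spaceD:
  assumes "v \<in> tangent_space \<A> p"
  shows "\<not> hol_near \<A> p f \<Longrightarrow> v f = 0"
    and "hol_near \<A> p f \<Longrightarrow> hol_near \<A> p h \<Longrightarrow> eventually (\<lambda>q. f q = h q) (nhds p) \<Longrightarrow> v f = v h"
    and "hol_near \<A> p f \<Longrightarrow> hol_near \<A> p h \<Longrightarrow> v (\<lambda>q. f q + h q) = v f + v h"
    and "hol_near \<A> p f \<Longrightarrow> v (\<lambda>q. c * f q) = c * v f"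
    and "hol_near \<A> p f \<Longrightarrow> hol_near \<A> p h \<Longrightarrow> v (\<lambda>q. f q * h q) = f p * v h + h p * v f"
  using assms unfolding tangent_space_def by simp_all

lemma tangent_vector_const:
  assumes "v \<in> tangent_space \<A> p"
  shows "v (\<lambda>q. c) = 0"
  using tangent_spaceD(5)[OF assms hol_near_const[of \<A> p 1] hol_near_const[of \<A> p 1]]
    tangent_spaceD(4)[OF assms hol_near_const[of \<A> p 1], of c] by simp

lemma tangent_vector_sum:
  assumes v: "v \<in> tangent_space \<A> p" and "\<And>i. i \<in> I \<Longrightarrow> hol_near \<A> p (f i)"
  shows "v (\<lambda>q. \<Sum>i\<in>I. f i q) = (\<Sum>i\<in>I. v (f i))"
  using assms(2)
proof (induction I rule: infinite_finite_induct)
  case (insert i I)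
  then show ?case by (simp add: tangent_spaceD(3)[OF v] hol_near_sum)
qed (simp_all add: tangent_vector_const[OF v])

lemma tangent_space_diff:
  assumes u: "u \<in> tangent_space \<A> p" and v: "v \<in> tangent_space \<A> p"
  shows "u - v \<in> tangent_space \<A> p"
proof -
  have germ: "u f - v f = u h - v h" if "hol_near \<A> p f" "hol_near \<A> p h" "\<forall>\<^sub>F q in nhds p. f q = h q" for f h
    using tangent_spaceD(2)[OF u that] tangent_spaceD(2)[OF v that] by simp
  show ?thesis
    unfolding tangent_space_def mem_Collect_eq
  proof (intro conjI allI impI)
    fix f h
    assume "hol_near \<A> p f \<and> hol_near \<A> p h \<and> (\<forall>\<^sub>F q in nhds p. f q = h q)"
    then show "(u - v) f = (u - v) h" using germ[of f h] by simp
  qed (simp_all add: tangent_spaceD(1,3,4,5)[OF u] tangent_spaceD(1,3,4,5)[OF v] algebra_simps)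
qed

locale holomorphic_atlas =
  fixes \<A> :: "('m::topological_space, 'n::finite) chart set"
  assumes atlas: "complex_atlas \<A>"
begin

lemma chart_at: obtains V \<phi> where "(V, \<phi>) \<in> \<A>" "p \<in> V"
  using atlas unfolding complex_atlas_def by blast

lemma chart_open: "(V, \<phi>) \<in> \<A> \<Longrightarrow> open V"
  using atlas unfolding complex_atlas_def is_chart_def by blast

lemma chart_homeomorphism:
  assumes "(V, \<phi>) \<in> \<A>"
  obtains \<psi> where "homeomorphism V (\<phi> ` V) \<phi> \<psi>" "open (\<phi> ` V)"
  using atlas assms unfolding complex_atlas_def is_chart_def by blast

lemma chart_inj: "(V, \<phi>) \<in> \<A> \<Longrightarrow> inj_on \<phi> V"
  by (erule chart_homeomorphism) (auto simp: homeomorphism_def intro: inj_on_inverseI)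

lemma chart_inv [simp]: "(V, \<phi>) \<in> \<A> \<Longrightarrow> q \<in> V \<Longrightarrow> inv_into V \<phi> (\<phi> q) = q"
  by (simp add: chart_inj)

lemma chart_open_image:
  assumes "(V, \<phi>) \<in> \<A>" "open U"
  shows "open (\<phi> ` (U \<inter> V))"
proof -
  obtain \<psi> where \<psi>: "homeomorphism V (\<phi> ` V) \<phi> \<psi>" "open (\<phi> ` V)" by (rule chart_homeomorphism[OF assms(1)])
  have "openin (top_of_set V) (U \<inter> V)"
    using assms by (auto simp: openin_open)
  then show ?thesis
    using homeomorphism_imp_open_map[OF \<psi>(1)] \<psi>(2) openin_open_trans by blast
qed

lemma chart_open_preimage:
  assumes "(V, \<phi>) \<in> \<A>" "open S"
  shows "open (V \<inter> \<phi> -` S)"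
proof -
  have "continuous_on V \<phi>"
    using chart_homeomorphism[OF assms(1)] unfolding homeomorphism_def by metis
  then show ?thesis
    using continuous_open_preimage chart_open assms by blast
qed

lemma transition_holomorphic:
  assumes "(U, \<phi>) \<in> \<A>" "(V, \<psi>) \<in> \<A>"
  shows "mv_holomorphic_on (\<lambda>z. \<phi> (inv_into V \<psi> z) $ i) (\<psi> ` (U \<inter> V))"
proof -
  have "\<forall>(U, \<phi>)\<in>\<A>. \<forall>(V, \<psi>)\<in>\<A>. \<forall>i.
      mv_holomorphic_on (\<lambda>z. \<phi> (inv_into V \<psi> z) $ i) (\<psi> ` (U \<inter> V))"
    using atlas unfolding complex_atlas_def by (elim conjE)
  from bspec[OF this assms(1)] have "\<forall>(V, \<psi>)\<in>\<A>. \<forall>i.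
      mv_holomorphic_on (\<lambda>z. \<phi> (inv_into V \<psi> z) $ i) (\<psi> ` (U \<inter> V))" by simp
  from bspec[OF this assms(2)] show ?thesis by simp
qed

lemma holfuns_cong:
  assumes "open U" "\<And>q. q \<in> U \<Longrightarrow> f q = h q" "f \<in> holfuns \<A> U"
  shows "h \<in> holfuns \<A> U"
proof (rule holfunsI)
  fix V \<phi> assume c: "(V, \<phi>) \<in> \<A>"
  show "mv_holomorphic_on (\<lambda>z. h (inv_into V \<phi> z)) (\<phi> ` (U \<inter> V))"
  proof (rule mv_holomorphic_on_cong[OF chart_open_image[OF c assms(1)]])
    show "mv_holomorphic_on (\<lambda>z. f (inv_into V \<phi> z)) (\<phi> ` (U \<inter> V))"
      by (rule holfunsD[OF assms(3) c])
  qed (use assms(2) c in auto)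
qed

lemma holfuns_chart:
  assumes c: "(V, \<phi>) \<in> \<A>" and F: "mv_holomorphic_on F S"
  shows "(\<lambda>q. F (\<phi> q)) \<in> holfuns \<A> (V \<inter> \<phi> -` S)"
proof (rule holfunsI)
  fix W \<psi> assume d: "(W, \<psi>) \<in> \<A>"
  show "mv_holomorphic_on (\<lambda>z. F (\<phi> (inv_into W \<psi> z))) (\<psi> ` (V \<inter> \<phi> -` S \<inter> W))"
    by (rule mv_holomorphic_on_compose[OF mv_holomorphic_on_subset[OF transition_holomorphic[OF c d]] F])
       (use d in auto)
qed

lemma hol_near_chart:
  assumes c: "(V, \<phi>) \<in> \<A>" and F: "mv_holomorphic_on F S" and "open S" "p \<in> V" "\<phi> p \<in> S"
  shows "hol_near \<A> p (\<lambda>q. F (\<phi> q))"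
  unfolding hol_near_def using holfuns_chart[OF c F] chart_open_preimage[OF c \<open>open S\<close>] assms(4,5)
  by (intro exI[of _ "V \<inter> \<phi> -` S"]) simp

lemma hol_near_in_chart:
  assumes c: "(V, \<phi>) \<in> \<A>" and "p \<in> V" and "hol_near \<A> p f"
  obtains r where "r > 0" "ball (\<phi> p) r \<subseteq> \<phi> ` V" "mv_holomorphic_on (\<lambda>z. f (inv_into V \<phi> z)) (ball (\<phi> p) r)"
proof -
  obtain U where U: "open U" "p \<in> U" "f \<in> holfuns \<A> U"
    using assms(3) unfolding hol_near_def by (elim exE conjE)
  have "open (\<phi> ` (U \<inter> V))" "\<phi> p \<in> \<phi> ` (U \<inter> V)"
    using chart_open_image[OF c U(1)] U(2) assms(2) by auto
  then obtain r where r: "r > 0" "ball (\<phi> p) r \<subseteq> \<phi> ` (U \<inter> V)"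
    using open_contains_ball by blast
  have "mv_holomorphic_on (\<lambda>z. f (inv_into V \<phi> z)) (\<phi> ` (U \<inter> V))"
    by (rule holfunsD[OF U(3) c])
  from mv_holomorphic_on_subset[OF this r(2)] r show ?thesis by (intro that[of r]) auto
qed

text \<open>
  The field with the constant components \<open>w\<close> in the chart \<open>(V, \<phi>)\<close>. The value 0 on functions that are not holomorphic
  near the point is the convention of \<open>tangent_space\<close>.
\<close>
definition coordinate_field :: "'m set \<Rightarrow> ('m \<Rightarrow> complex^'n) \<Rightarrow> complex^'n \<Rightarrow> 'm vfield" where
  "coordinate_field V \<phi> w = (\<lambda>q f. if hol_near \<A> q f
     then frechet_derivative (\<lambda>z. f (inv_into V \<phi> z)) (at (\<phi> q)) w else 0)"

lemma coordinate_field_tangent: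
  assumes c: "(V, \<phi>) \<in> \<A>" and p: "p \<in> V"
  shows "coordinate_field V \<phi> w p \<in> tangent_space \<A> p"
proof -
  let ?F = "\<lambda>f z. f (inv_into V \<phi> z)"
  have der: "(?F f has_derivative frechet_derivative (?F f) (at (\<phi> p))) (at (\<phi> p))" if f: "hol_near \<A> p f" for f
  proof -
    obtain r where "r > 0" "ball (\<phi> p) r \<subseteq> \<phi> ` V" "mv_holomorphic_on (?F f) (ball (\<phi> p) r)"
      by (rule hol_near_in_chart[OF c p f])
    then show ?thesis by (intro mv_holomorphic_onD(1)) auto
  qed
  have germ: "frechet_derivative (?F f) (at (\<phi> p)) = frechet_derivative (?F h) (at (\<phi> p))"
    if f: "hol_near \<A> p f" and ev: "\<forall>\<^sub>F q in nhds p. f q = h q" for f h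
  proof -
    obtain U where U: "open U" "p \<in> U" "\<And>q. q \<in> U \<Longrightarrow> f q = h q"
      using ev unfolding eventually_nhds by blast
    have "(?F h has_derivative frechet_derivative (?F f) (at (\<phi> p))) (at (\<phi> p))"
      by (rule has_derivative_transform_within_open[OF der[OF f] chart_open_image[OF c U(1)]])
         (use U(2,3) p c in auto)
    then show ?thesis by (rule frechet_derivative_at)
  qed
  have add: "frechet_derivative (\<lambda>z. ?F f z + ?F h z) (at (\<phi> p)) w =
      frechet_derivative (?F f) (at (\<phi> p)) w + frechet_derivative (?F h) (at (\<phi> p)) w"
    if "hol_near \<A> p f" "hol_near \<A> p h" for f h
    using fun_cong[OF frechet_derivative_at[OF has_derivative_add[OF der[OF that(1)] der[OF that(2)]]], of w] by simp
  have mult: "frechet_derivative (\<lambda>z. ?F f z * ?F h z) (at (\<phi> p)) w =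
      f p * frechet_derivative (?F h) (at (\<phi> p)) w + h p * frechet_derivative (?F f) (at (\<phi> p)) w"
    if "hol_near \<A> p f" "hol_near \<A> p h" for f h
    using fun_cong[OF frechet_derivative_at[OF has_derivative_mult[OF der[OF that(1)] der[OF that(2)]]], of w] c p
    by (simp add: mult.commute)
  have scale: "frechet_derivative (\<lambda>z. a * ?F f z) (at (\<phi> p)) w = a * frechet_derivative (?F f) (at (\<phi> p)) w"
    if "hol_near \<A> p f" for f a
    using fun_cong[OF frechet_derivative_at[OF has_derivative_mult_right[OF der[OF that]]], of a w] by simp
  show ?thesis
    unfolding tangent_space_def mem_Collect_eq
  proof (intro conjI allI impI)
    fix f h
    assume "hol_near \<A> p f \<and> hol_near \<A> p h \<and> (\<forall>\<^sub>F q in nhds p. f q = h q)"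
    then show "coordinate_field V \<phi> w p f = coordinate_field V \<phi> w p h"
      using germ[of f h] by (simp add: coordinate_field_def)
  qed (simp_all add: coordinate_field_def hol_near_add hol_near_mult hol_near_const add mult scale)
qed

lemma coordinate_field_vfields:
  assumes c: "(V, \<phi>) \<in> \<A>"
  shows "coordinate_field V \<phi> w \<in> vfields \<A> V"
  unfolding vfields_def mem_Collect_eq
proof (intro conjI ballI allI impI)
  fix U f assume *: "open U \<and> U \<subseteq> V \<and> f \<in> holfuns \<A> U"
  then have U: "U \<inter> V = U" "open (\<phi> ` U)" using chart_open_image[OF c, of U] by (auto simp: Int_absorb2)
  let ?F = "\<lambda>z. f (inv_into V \<phi> z)"
  have "mv_holomorphic_on ?F (\<phi> ` (U \<inter> V))"
    using * holfunsD[OF _ c] by simp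
  then have "mv_holomorphic_on (\<lambda>z. frechet_derivative ?F (at z) w) (\<phi> ` U)"
    using U by (intro mv_holomorphic_on_frechet_derivative) simp_all
  from holfuns_chart[OF c this]
  have "(\<lambda>q. frechet_derivative ?F (at (\<phi> q)) w) \<in> holfuns \<A> (V \<inter> \<phi> -` (\<phi> ` U))" .
  then have "(\<lambda>q. frechet_derivative ?F (at (\<phi> q)) w) \<in> holfuns \<A> U"
    by (rule holfuns_subset) (use * in auto)
  then show "deriv_along (coordinate_field V \<phi> w) f \<in> holfuns \<A> U"
  proof (rule holfuns_cong[rotated 2])
    fix q assume "q \<in> U"
    then have "hol_near \<A> q f" using * unfolding hol_near_def by (intro exI[of _ U]) simp
    then show "frechet_derivative ?F (at (\<phi> q)) w = deriv_along (coordinate_field V \<phi> w) f q"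
      by (simp add: deriv_along_def coordinate_field_def)
  qed (use * in simp)
qed (rule coordinate_field_tangent[OF c])

text \<open>
  By Hadamard's lemma a function is near \<open>p\<close> a constant plus products of a function vanishing at \<open>p\<close>
  (a coordinate difference) with a holomorphic function. The Leibniz rule then leaves only the values of \<open>v\<close> on the
  coordinates.
\<close>
lemma tangent_vector_coordinates:
  assumes c: "(V, \<phi>) \<in> \<A>" and p: "p \<in> V" and v: "v \<in> tangent_space \<A> p"
  shows "v = coordinate_field V \<phi> (\<chi> i. v (\<lambda>q. \<phi> q $ i)) p"
proof
  fix f
  show "v f = coordinate_field V \<phi> (\<chi> i. v (\<lambda>q. \<phi> q $ i)) p f"
  proof (cases "hol_near \<A> p f")
    case True
    let ?F = "\<lambda>z. f (inv_into V \<phi> z)" and ?a = "\<phi> p"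
    obtain r where r: "r > 0" "ball ?a r \<subseteq> \<phi> ` V" "mv_holomorphic_on ?F (ball ?a r)"
      by (rule hol_near_in_chart[OF c p True])
    obtain H where H: "\<And>i. mv_holomorphic_on (H i) (ball ?a r)"
      "\<And>z. z \<in> ball ?a r \<Longrightarrow> ?F z = ?F ?a + (\<Sum>i\<in>UNIV. (z $ i - ?a $ i) * H i z)"
      "\<And>i. H i ?a = frechet_derivative ?F (at ?a) (axis i 1)"
      by (rule hadamard_mv_holomorphic[OF r(3,1)]) blast
    have near_H: "hol_near \<A> p (\<lambda>q. H i (\<phi> q))" for i
      by (rule hol_near_chart[OF c H(1) open_ball p]) (use r in simp)
    have near_\<phi>: "hol_near \<A> p (\<lambda>q. \<phi> q $ i)" for i
      by (rule hol_near_chart[OF c _ open_UNIV p]) simp_all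
    have near_x: "hol_near \<A> p (\<lambda>q. \<phi> q $ i - ?a $ i)" for i
      using hol_near_add[OF near_\<phi> hol_near_const[of \<A> p "- ?a $ i"]] by simp
    have vx: "v (\<lambda>q. \<phi> q $ i - ?a $ i) = v (\<lambda>q. \<phi> q $ i)" for i
      using tangent_spaceD(3)[OF v near_\<phi> hol_near_const[of \<A> p "- ?a $ i"]] tangent_vector_const[OF v] by simp
    have near: "hol_near \<A> p (\<lambda>q. \<Sum>i\<in>UNIV. (\<phi> q $ i - ?a $ i) * H i (\<phi> q))"
      by (intro hol_near_sum hol_near_mult near_x near_H)
    have "\<forall>\<^sub>F q in nhds p. f q = ?F ?a + (\<Sum>i\<in>UNIV. (\<phi> q $ i - ?a $ i) * H i (\<phi> q))"
      unfolding eventually_nhds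
    proof (intro exI conjI ballI)
      show "open (V \<inter> \<phi> -` ball ?a r)" by (rule chart_open_preimage[OF c open_ball])
      show "p \<in> V \<inter> \<phi> -` ball ?a r" using p r by simp
      fix q assume "q \<in> V \<inter> \<phi> -` ball ?a r"
      then show "f q = ?F ?a + (\<Sum>i\<in>UNIV. (\<phi> q $ i - ?a $ i) * H i (\<phi> q))"
        using H(2)[of "\<phi> q"] c by simp
    qed
    then have "v f = v (\<lambda>q. ?F ?a + (\<Sum>i\<in>UNIV. (\<phi> q $ i - ?a $ i) * H i (\<phi> q)))"
      by (rule tangent_spaceD(2)[OF v True hol_near_add[OF hol_near_const near]])
    also have "\<dots> = (\<Sum>i\<in>UNIV. v (\<lambda>q. (\<phi> q $ i - ?a $ i) * H i (\<phi> q)))"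
      by (simp add: tangent_spaceD(3)[OF v hol_near_const near] tangent_vector_const[OF v]
          tangent_vector_sum[OF v] hol_near_mult near_x near_H)
    also have "\<dots> = (\<Sum>i\<in>UNIV. v (\<lambda>q. \<phi> q $ i) * frechet_derivative ?F (at ?a) (axis i 1))"
      by (simp add: tangent_spaceD(5)[OF v near_x near_H] vx H(3)) (simp add: mult.commute)
    also have "\<dots> = frechet_derivative ?F (at ?a) (\<chi> i. v (\<lambda>q. \<phi> q $ i))"
      using frechet_derivative_expansion[OF r(3), of ?a "\<chi> i. v (\<lambda>q. \<phi> q $ i)"] r(1) by simp
    finally show ?thesis using True by (simp add: coordinate_field_def)
  qed (simp add: coordinate_field_def tangent_spaceD(1)[OF v])
qed

lemma vfields_subset: "X \<in> vfields \<A> U \<Longrightarrow> V \<subseteq> U \<Longrightarrow> X \<in> vfields \<A> V"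
  unfolding vfields_def by (auto dest: subset_trans)

text \<open>
  This is what makes nondegeneracy of a metric at a point applicable to identities between local
  vector fields.
\<close>
lemma tangent_vector_extends:
  assumes "v \<in> tangent_space \<A> p" "open U" "p \<in> U"
  obtains V X where "open V" "p \<in> V" "V \<subseteq> U" "X \<in> vfields \<A> V" "X p = v"
proof -
  obtain V \<phi> where c: "(V, \<phi>) \<in> \<A>" "p \<in> V" by (rule chart_at)
  show ?thesis
  proof (rule that)
    show "coordinate_field V \<phi> (\<chi> i. v (\<lambda>q. \<phi> q $ i)) \<in> vfields \<A> (U \<inter> V)"
      using coordinate_field_vfields[OF c(1)] by (rule vfields_subset) simp
  qed (use tangent_vector_coordinates[OF c assms(1)] c assms chart_open in auto)
qed

lemma vfields_cong:
  assumes "open U" "\<And>p. p \<in> U \<Longrightarrow> X p = Y p" "X \<in> vfields \<A> U"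
  shows "Y \<in> vfields \<A> U"
  unfolding vfields_def mem_Collect_eq
proof (intro conjI ballI allI impI)
  fix p assume "p \<in> U"
  then show "Y p \<in> tangent_space \<A> p" using assms unfolding vfields_def by auto
next
  fix V f assume *: "open V \<and> V \<subseteq> U \<and> f \<in> holfuns \<A> V"
  then have "deriv_along X f \<in> holfuns \<A> V" using assms unfolding vfields_def by simp
  then show "deriv_along Y f \<in> holfuns \<A> V"
    by (rule holfuns_cong[rotated 2]) (use * assms in \<open>auto simp: deriv_along_def\<close>)
qed

lemma vfields_diff:
  assumes "X \<in> vfields \<A> U" "Y \<in> vfields \<A> U"
  shows "X - Y \<in> vfields \<A> U"
  unfolding vfields_def mem_Collect_eq
proof (intro conjI ballI allI impI)
  fix p assume "p \<in> U"
  then show "(X - Y) p \<in> tangent_space \<A> p"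
    using assms tangent_space_diff[of "X p" \<A> p "Y p"] unfolding vfields_def by simp
next
  fix V f assume "open V \<and> V \<subseteq> U \<and> f \<in> holfuns \<A> V"
  then have "deriv_along X f \<in> holfuns \<A> V" "deriv_along Y f \<in> holfuns \<A> V"
    using assms unfolding vfields_def by simp_all
  from holfuns_add[OF this(1) holfuns_mult[OF holfuns_const[of "-1"] this(2)]]
  show "deriv_along (X - Y) f \<in> holfuns \<A> V"
    by (simp add: deriv_along_def)
qed

end

section \<open>Algebras with a torsion-free connection\<close>

text \<open>
  The identities between \<open>\<circ>\<close>, its derivatives and the bracket are purely algebraic. Here \<open>R\<close> stands
  for the vector fields on a fixed open set, represented so that fields which agree there are equal.
\<close>
locale product_with_connection =
  fixes R :: "'a::ab_group_add set"
    and mult :: "'a \<Rightarrow> 'a \<Rightarrow> 'a" (infixl "\<odot>" 70)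
    and nabla :: "'a \<Rightarrow> 'a \<Rightarrow> 'a"
  assumes diff_closed: "X \<in> R \<Longrightarrow> Y \<in> R \<Longrightarrow> X - Y \<in> R"
    and mult_closed: "X \<in> R \<Longrightarrow> Y \<in> R \<Longrightarrow> X \<odot> Y \<in> R"
    and nabla_closed: "X \<in> R \<Longrightarrow> Y \<in> R \<Longrightarrow> nabla X Y \<in> R"
    and mult_commute: "X \<in> R \<Longrightarrow> Y \<in> R \<Longrightarrow> X \<odot> Y = Y \<odot> X"
    and mult_assoc: "X \<in> R \<Longrightarrow> Y \<in> R \<Longrightarrow> Z \<in> R \<Longrightarrow> X \<odot> Y \<odot> Z = X \<odot> (Y \<odot> Z)"
    and mult_diff: "X \<in> R \<Longrightarrow> Y \<in> R \<Longrightarrow> Z \<in> R \<Longrightarrow> X \<odot> (Y - Z) = X \<odot> Y - X \<odot> Z"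
begin

lemma zero_closed: "X \<in> R \<Longrightarrow> 0 \<in> R"
  using diff_closed[of X X] by simp

lemma add_closed: "X \<in> R \<Longrightarrow> Y \<in> R \<Longrightarrow> X + Y \<in> R"
  using diff_closed[of X "0 - Y"] diff_closed[of 0 Y] zero_closed[of X] by simp

lemmas closed = add_closed diff_closed mult_closed nabla_closed

lemma mult_add: "X \<in> R \<Longrightarrow> Y \<in> R \<Longrightarrow> Z \<in> R \<Longrightarrow> X \<odot> (Y + Z) = X \<odot> Y + X \<odot> Z"
  using mult_diff[of X "Y + Z" Z] by (simp add: add_closed)

lemma mult_left_commute: "X \<in> R \<Longrightarrow> Y \<in> R \<Longrightarrow> Z \<in> R \<Longrightarrow> X \<odot> (Y \<odot> Z) = Y \<odot> (X \<odot> Z)"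
  by (metis mult_assoc mult_commute)

lemma diff_mult: "X \<in> R \<Longrightarrow> Y \<in> R \<Longrightarrow> Z \<in> R \<Longrightarrow> (Y - Z) \<odot> X = Y \<odot> X - Z \<odot> X"
  by (metis mult_diff mult_commute diff_closed)

lemmas mult_ac = mult_assoc mult_commute mult_left_commute

definition cov_mult :: "'a \<Rightarrow> 'a \<Rightarrow> 'a \<Rightarrow> 'a" where
  "cov_mult X Y Z = nabla X (Y \<odot> Z) - nabla X Y \<odot> Z - Y \<odot> nabla X Z"

text \<open>
  The bracket is determined by \<open>nabla\<close> because the connection is torsion free.
\<close>
definition bracket :: "'a \<Rightarrow> 'a \<Rightarrow> 'a" where
  "bracket X Y = nabla X Y - nabla Y X"

definition lie_deriv :: "'a \<Rightarrow> 'a \<Rightarrow> 'a \<Rightarrow> 'a" where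
  "lie_deriv X Y Z = bracket X (Y \<odot> Z) - bracket X Y \<odot> Z - Y \<odot> bracket X Z"

definition F_defect :: "'a \<Rightarrow> 'a \<Rightarrow> 'a \<Rightarrow> 'a \<Rightarrow> 'a" where
  "F_defect X Y Z W = lie_deriv (X \<odot> Y) Z W - (X \<odot> lie_deriv Y Z W + Y \<odot> lie_deriv X Z W)"

lemma cov_mult_closed [simp]: "X \<in> R \<Longrightarrow> Y \<in> R \<Longrightarrow> Z \<in> R \<Longrightarrow> cov_mult X Y Z \<in> R"
  by (simp add: cov_mult_def closed)

lemma cov_mult_commute: "X \<in> R \<Longrightarrow> Y \<in> R \<Longrightarrow> Z \<in> R \<Longrightarrow> cov_mult X Y Z = cov_mult X Z Y"
  by (simp add: cov_mult_def closed mult_commute)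

text \<open>
  Both sides are the failure of \<open>nabla V\<close> to satisfy the Leibniz rule on the triple product of \<open>X\<close>, \<open>Y\<close> and \<open>Z\<close>.
\<close>
lemma cov_mult_cocycle:
  assumes "V \<in> R" "X \<in> R" "Y \<in> R" "Z \<in> R"
  shows "cov_mult V (X \<odot> Y) Z + Z \<odot> cov_mult V X Y = cov_mult V X (Y \<odot> Z) + X \<odot> cov_mult V Y Z"
  using assms by (simp add: cov_mult_def closed mult_add mult_diff diff_mult mult_ac algebra_simps)

text \<open>
  Substituting \<open>nabla X Y - nabla Y X\<close> for the bracket, all terms assemble into values of
  the covariant derivative of the multiplication, in the directions of the four fields and of the two products.
\<close>
lemma F_defect_eq:
  assumes "X \<in> R" "Y \<in> R" "Z \<in> R" "W \<in> R"
  shows "F_defect X Y Z W = cov_mult (X \<odot> Y) Z W - X \<odot> cov_mult Y Z W - Y \<odot> cov_mult X Z W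
    - cov_mult (Z \<odot> W) X Y + W \<odot> cov_mult Z X Y + Z \<odot> cov_mult W X Y"
  using assms
  by (simp add: F_defect_def lie_deriv_def bracket_def cov_mult_def closed mult_add mult_diff diff_mult mult_ac algebra_simps)

text \<open>
  Symmetry puts an argument that is not a product into the direction of differentiation. Then the
  cocycle identity for the direction \<open>Z\<close> and that for the direction \<open>X\<close> account for three terms each, and they have the term
  \<open>cov_mult X Z (Y \<odot> W)\<close> in common.
\<close>
lemma F_defect_eq_0:
  assumes sym: "\<And>X Y Z. X \<in> R \<Longrightarrow> Y \<in> R \<Longrightarrow> Z \<in> R \<Longrightarrow> cov_mult X Y Z = cov_mult Y X Z"
    and R: "X \<in> R" "Y \<in> R" "Z \<in> R" "W \<in> R"
  shows "F_defect X Y Z W = 0"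
proof -
  have 1: "cov_mult (X \<odot> Y) Z W + W \<odot> cov_mult Z X Y = cov_mult X Z (Y \<odot> W) + X \<odot> cov_mult Y Z W"
    using cov_mult_cocycle[of Z X Y W] R sym[of Z "X \<odot> Y" W] sym[of Z X "Y \<odot> W"] sym[of Z Y W]
    by (simp add: closed)
  have 2: "cov_mult (Z \<odot> W) X Y + Y \<odot> cov_mult X Z W = cov_mult X Z (Y \<odot> W) + Z \<odot> cov_mult W X Y"
    using cov_mult_cocycle[of X Z W Y] R sym[of W X Y] sym[of "Z \<odot> W" X Y] mult_commute[of W Y]
    by (simp add: closed)
  have "a - b - c - d + p + q = 0" if "a + p = r + b" "d + c = r + q" for a b c d p q r :: 'a
  proof -
    have "a = r + b - p" "d = r + q - c" using that by (simp_all add: eq_diff_eq)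
    then show ?thesis by simp
  qed
  from this[OF 1 2] show ?thesis
    using R by (simp add: F_defect_eq)
qed

end

text \<open>
  \<open>B\<close> is the metric evaluated at one point. The two sides of \<open>B_nabla\<close> are the derivative along \<open>X\<close> of
  one and the same function \<open>g(Y, Z \<circ> W) = g(Z, Y \<circ> W)\<close>, computed by metric compatibility of \<open>nabla\<close>; in this form no
  functions have to be mentioned.
\<close>
locale metric_product_with_connection = product_with_connection +
  fixes e :: 'a and B :: "'a \<Rightarrow> 'a \<Rightarrow> complex"
  assumes e: "e \<in> R" and e_mult: "X \<in> R \<Longrightarrow> e \<odot> X = X"
    and B_diff: "X \<in> R \<Longrightarrow> Y \<in> R \<Longrightarrow> Z \<in> R \<Longrightarrow> B X (Y - Z) = B X Y - B X Z"
    and B_mult: "X \<in> R \<Longrightarrow> Y \<in> R \<Longrightarrow> Z \<in> R \<Longrightarrow> B X (Y \<odot> Z) = B Y (X \<odot> Z)"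
    and B_nabla: "X \<in> R \<Longrightarrow> Y \<in> R \<Longrightarrow> Z \<in> R \<Longrightarrow> W \<in> R \<Longrightarrow>
      B (nabla X Y) (Z \<odot> W) + B Y (nabla X (Z \<odot> W)) = B (nabla X Z) (Y \<odot> W) + B Z (nabla X (Y \<odot> W))"
begin

lemma cov_mult_unit: "X \<in> R \<Longrightarrow> Y \<in> R \<Longrightarrow> cov_mult X e Y = - (nabla X e \<odot> Y)"
  by (simp add: cov_mult_def closed e e_mult)

lemma B_e: "X \<in> R \<Longrightarrow> Y \<in> R \<Longrightarrow> B e (X \<odot> Y) = B X Y"
  by (simp add: B_mult[of e] e_mult e)

lemma B_add: "X \<in> R \<Longrightarrow> Y \<in> R \<Longrightarrow> Z \<in> R \<Longrightarrow> B X (Y + Z) = B X Y + B X Z"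
  using B_diff[of X "Y + Z" Z] by (simp add: add_closed)

text \<open>
  By symmetry \<open>nabla Y e \<odot> X\<close> and \<open>nabla X e \<odot> Y\<close> agree; pairing them with \<open>e\<close> gives the
  claim, which is closedness of \<open>\<epsilon>\<close> by \<open>ext_deriv_coidentity\<close>.
\<close>
lemma coidentity_closed:
  assumes sym: "\<And>X Y Z. X \<in> R \<Longrightarrow> Y \<in> R \<Longrightarrow> Z \<in> R \<Longrightarrow> cov_mult X Y Z = cov_mult Y X Z"
    and R: "X \<in> R" "Y \<in> R"
  shows "B X (nabla Y e) = B Y (nabla X e)"
proof -
  have "nabla Y e \<odot> X = nabla X e \<odot> Y"
    using sym[of X Y e] cov_mult_unit[of X Y] cov_mult_unit[of Y X] cov_mult_commute[of X Y e] cov_mult_commute[of Y X e] R e by simp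
  then show ?thesis
    using B_e[of "X" "nabla Y e"] B_e[of Y "nabla X e"] R e
    by (metis mult_commute nabla_closed)
qed

lemma B_cov_mult_swap:
  assumes "X \<in> R" "Y \<in> R" "Z \<in> R" "W \<in> R"
  shows "B Y (cov_mult X Z W) = B Z (cov_mult X Y W)"
  using B_nabla[OF assms] B_mult[of Y "nabla X Z" W] B_mult[of Z "nabla X Y" W] B_mult[of Y Z "nabla X W"] assms
  by (simp add: cov_mult_def closed B_add B_diff algebra_simps)

lemma B_e_cov_mult:
  assumes "V \<in> R" "Z \<in> R" "W \<in> R"
  shows "B e (cov_mult V Z W) = - B (Z \<odot> W) (nabla V e)"
proof -
  have "B e (cov_mult V Z W) = B Z (- (nabla V e \<odot> W))"
    using B_cov_mult_swap[of V e Z W] cov_mult_unit[of V W] assms e by simp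
  also have "\<dots> = - B Z (nabla V e \<odot> W)"
    using B_diff[of Z 0 "nabla V e \<odot> W"] B_diff[of Z 0 0] zero_closed[of Z] assms e by (simp add: closed)
  also have "B Z (nabla V e \<odot> W) = B (Z \<odot> W) (nabla V e)"
    using B_mult[of Z "nabla V e" W] B_mult[of "nabla V e" "Z \<odot> W" e] mult_commute[of e] assms e
    by (simp add: closed e_mult)
  finally show ?thesis .
qed

text \<open>
  Pairing \<open>F_defect\<close> with \<open>e\<close> makes the two terms with a product in the direction of differentiation cancel, by
  \<open>B_e_cov_mult\<close> and closedness. The remaining four terms are the values of the tensor \<open>\<nabla>A\<close> with each of the
  four fields as direction, and two of them have the same sum as the other two. Two arrangements of
  the fields give the claim.
\<close>
lemma B_cov_mult_eq:
  assumes F: "\<And>X Y Z W. X \<in> R \<Longrightarrow> Y \<in> R \<Longrightarrow> Z \<in> R \<Longrightarrow> W \<in> R \<Longrightarrow> F_defect X Y Z W = 0"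
    and cl: "\<And>X Y. X \<in> R \<Longrightarrow> Y \<in> R \<Longrightarrow> B X (nabla Y e) = B Y (nabla X e)"
    and R: "X \<in> R" "Y \<in> R" "Z \<in> R" "W \<in> R"
  shows "B Y (cov_mult X Z W) = B X (cov_mult Y Z W)"
proof -
  have *: "B X (cov_mult Y Z W) + B Y (cov_mult X Z W) = B W (cov_mult Z X Y) + B Z (cov_mult W X Y)"
    if R: "X \<in> R" "Y \<in> R" "Z \<in> R" "W \<in> R" for X Y Z W
  proof -
    have "B e (F_defect X Y Z W) = 0"
      using F[OF R] B_diff[of e e e] e by (simp add: B_diff[of e 0 0, simplified])
    then show ?thesis
      using R e cl[of "X \<odot> Y" "Z \<odot> W"]
      by (simp add: F_defect_eq closed B_diff B_add B_e B_e_cov_mult algebra_simps)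
  qed
  show ?thesis
    using *[of X Z Y W] *[of Y Z X W] R B_cov_mult_swap[of Z X Y W] B_cov_mult_swap[of X Y Z W] B_cov_mult_swap[of Y W X Z]
      B_cov_mult_swap[of W X Y Z] B_cov_mult_swap[of Y Z X W] B_cov_mult_swap[of X W Y Z] cov_mult_commute[of Y Z W] cov_mult_commute[of X Z W]
    by (simp add: complex_eq_iff)
qed

end

section \<open>Symmetry of tensors\<close>

text \<open>
  Transpositions generate the symmetric group.
\<close>
lemma symmetric_tensorI:
  assumes swap: "\<And>U X a b. open U \<Longrightarrow> \<forall>i<k. X i \<in> vfields \<A> U \<Longrightarrow> a < k \<Longrightarrow> b < k \<Longrightarrow>
      eq_on U (T (X \<circ> Transposition.transpose a b)) (T X)"
  shows "symmetric_tensor \<A> k T"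
  unfolding symmetric_tensor_def
proof (intro allI impI, elim conjE)
  fix U X \<pi>
  assume U: "open U" and X: "\<forall>i<k. X i \<in> vfields \<A> U" and \<pi>: "\<pi> permutes {..<k}"
  from \<pi> finite_lessThan have "\<forall>X. (\<forall>i<k. X i \<in> vfields \<A> U) \<longrightarrow> eq_on U (T (X \<circ> \<pi>)) (T X)"
  proof (induction \<pi> rule: permutes_induct)
    case id
    show ?case by (simp add: eq_on_def)
  next
    case (swap a b q)
    show ?case
    proof (intro allI impI)
      fix X assume X: "\<forall>i<k. X i \<in> vfields \<A> U"
      then have "\<forall>i<k. (X \<circ> Transposition.transpose a b) i \<in> vfields \<A> U"
        using swap.hyps by (simp add: Transposition.transpose_def)
      then have "eq_on U (T ((X \<circ> Transposition.transpose a b) \<circ> q)) (T (X \<circ> Transposition.transpose a b))"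
        using swap.IH by blast
      moreover have "eq_on U (T (X \<circ> Transposition.transpose a b)) (T X)"
        using assms U X swap.hyps by simp
      ultimately show "eq_on U (T (X \<circ> (Transposition.transpose a b \<circ> q))) (T X)"
        by (simp add: eq_on_def comp_assoc)
    qed
  qed
  then show "eq_on U (T (X \<circ> \<pi>)) (T X)" using X by blast
qed

lemma symmetric_tensorD:
  assumes "symmetric_tensor \<A> k T" "open U" "\<And>i. i < k \<Longrightarrow> X i \<in> vfields \<A> U" "a < k" "b < k" "p \<in> U"
  shows "T (X \<circ> Transposition.transpose a b) p = T X p"
  using assms(1)[unfolded symmetric_tensor_def, rule_format, of U X "Transposition.transpose a b"]
    assms(2-) permutes_swap_id[of a "{..<k}" b] by (simp add: eq_on_def)

text \<open>
  The adjacent swaps of the right-hand side, used as permutative rewrite rules, sort the arguments and thereby prove the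
  invariance under all transpositions. The same holds for four arguments below.
\<close>
lemma symmetric_tensor_3_iff:
  fixes T :: "'m vfield \<Rightarrow> 'm vfield \<Rightarrow> 'm vfield \<Rightarrow> ('m :: topological_space) \<Rightarrow> 'b"
  shows "symmetric_tensor \<A> 3 (\<lambda>X. T (X 0) (X 1) (X 2)) \<longleftrightarrow>
    (\<forall>U. open U \<longrightarrow> (\<forall>X\<in>vfields \<A> U. \<forall>Y\<in>vfields \<A> U. \<forall>Z\<in>vfields \<A> U. \<forall>p\<in>U.
      T X Y Z p = T Y X Z p \<and> T X Y Z p = T X Z Y p))" (is "?L \<longleftrightarrow> ?R")
proof
  assume L: ?L
  show ?R
  proof (intro allI impI ballI)
    fix U X Y Z p
    assume *: "open U" "X \<in> vfields \<A> U" "Y \<in> vfields \<A> U" "Z \<in> vfields \<A> U" "p \<in> U"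
    let ?X = "\<lambda>i::nat. if i = 0 then X else if i = 1 then Y else Z"
    show "T X Y Z p = T Y X Z p \<and> T X Y Z p = T X Z Y p"
      using symmetric_tensorD[OF L *(1), of ?X 0 1 p] symmetric_tensorD[OF L *(1), of ?X 1 2 p] *
      by (simp add: Transposition.transpose_def)
  qed
next
  assume R: ?R
  show ?L
  proof (rule symmetric_tensorI)
    fix U and X :: "nat \<Rightarrow> 'm vfield" and a b :: nat
    assume U: "open U" and X: "\<forall>i<3. X i \<in> vfields \<A> U" and ab: "a < 3" "b < 3"
    have V: "X 0 \<in> vfields \<A> U" "X 1 \<in> vfields \<A> U" "X 2 \<in> vfields \<A> U" using X by simp_all
    have swap: "T A B C p = T B A C p" "T A B C p = T A C B p"
      if "A \<in> vfields \<A> U" "B \<in> vfields \<A> U" "C \<in> vfields \<A> U" "p \<in> U" for A B C p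
      using R U that by blast+
    have "a = 0 \<or> a = 1 \<or> a = 2" "b = 0 \<or> b = 1 \<or> b = 2" using ab by auto
    then show "eq_on U (T ((X \<circ> Transposition.transpose a b) 0) ((X \<circ> Transposition.transpose a b) 1) ((X \<circ> Transposition.transpose a b) 2)) (T (X 0) (X 1) (X 2))"
      unfolding eq_on_def using V by (elim disjE) (simp_all add: Transposition.transpose_def swap)
  qed
qed

lemma symmetric_tensor_4_iff:
  fixes T :: "'m vfield \<Rightarrow> 'm vfield \<Rightarrow> 'm vfield \<Rightarrow> 'm vfield \<Rightarrow> ('m :: topological_space) \<Rightarrow> 'b"
  shows "symmetric_tensor \<A> 4 (\<lambda>X. T (X 0) (X 1) (X 2) (X 3)) \<longleftrightarrow>
    (\<forall>U. open U \<longrightarrow> (\<forall>X\<in>vfields \<A> U. \<forall>Y\<in>vfields \<A> U. \<forall>Z\<in>vfields \<A> U. \<forall>W\<in>vfields \<A> U. \<forall>p\<in>U.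
      T X Y Z W p = T Y X Z W p \<and> T X Y Z W p = T X Z Y W p \<and> T X Y Z W p = T X Y W Z p))" (is "?L \<longleftrightarrow> ?R")
proof
  assume L: ?L
  show ?R
  proof (intro allI impI ballI)
    fix U X Y Z W p
    assume *: "open U" "X \<in> vfields \<A> U" "Y \<in> vfields \<A> U" "Z \<in> vfields \<A> U" "W \<in> vfields \<A> U" "p \<in> U"
    let ?X = "\<lambda>i::nat. if i = 0 then X else if i = 1 then Y else if i = 2 then Z else W"
    show "T X Y Z W p = T Y X Z W p \<and> T X Y Z W p = T X Z Y W p \<and> T X Y Z W p = T X Y W Z p"
      using symmetric_tensorD[OF L *(1), of ?X 0 1 p] symmetric_tensorD[OF L *(1), of ?X 1 2 p]
        symmetric_tensorD[OF L *(1), of ?X 2 3 p] *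
      by (simp add: Transposition.transpose_def)
  qed
next
  assume R: ?R
  show ?L
  proof (rule symmetric_tensorI)
    fix U and X :: "nat \<Rightarrow> 'm vfield" and a b :: nat
    assume U: "open U" and X: "\<forall>i<4. X i \<in> vfields \<A> U" and ab: "a < 4" "b < 4"
    have V: "X 0 \<in> vfields \<A> U" "X 1 \<in> vfields \<A> U" "X 2 \<in> vfields \<A> U" "X 3 \<in> vfields \<A> U" using X by simp_all
    have swap: "T A B C E p = T B A C E p" "T A B C E p = T A C B E p" "T A B C E p = T A B E C p"
      if "A \<in> vfields \<A> U" "B \<in> vfields \<A> U" "C \<in> vfields \<A> U" "E \<in> vfields \<A> U" "p \<in> U" for A B C E p
      using R U that by blast+
    have "a = 0 \<or> a = 1 \<or> a = 2 \<or> a = 3" "b = 0 \<or> b = 1 \<or> b = 2 \<or> b = 3" using ab by auto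
    then show "eq_on U (T ((X \<circ> Transposition.transpose a b) 0) ((X \<circ> Transposition.transpose a b) 1) ((X \<circ> Transposition.transpose a b) 2) ((X \<circ> Transposition.transpose a b) 3))
        (T (X 0) (X 1) (X 2) (X 3))"
      unfolding eq_on_def using V by (elim disjE) (simp_all add: Transposition.transpose_def swap)
  qed
qed

section \<open>Sections over an open set\<close>

text \<open>
  Extension by zero picks one representative of each local vector field, so that the algebra above, which uses
  equality, applies to the operations on the tangent sheaf.
\<close>
definition zero_ext :: "'m set \<Rightarrow> 'm vfield \<Rightarrow> 'm vfield" where
  "zero_ext U X = (\<lambda>p. if p \<in> U then X p else 0)"

definition sections :: "('m::topological_space, 'n::finite) chart set \<Rightarrow> 'm set \<Rightarrow> 'm vfield set" where
  "sections \<A> U = {X \<in> vfields \<A> U. \<forall>p. p \<notin> U \<longrightarrow> X p = 0}"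

lemma zero_ext_eq_iff: "zero_ext U X = zero_ext U Y \<longleftrightarrow> eq_on U X Y"
  by (auto simp: zero_ext_def eq_on_def fun_eq_iff)

lemma zero_ext_apply [simp]: "p \<in> U \<Longrightarrow> zero_ext U X p = X p"
  by (simp add: zero_ext_def)

lemma zero_ext_diff: "zero_ext U (X - Y) = zero_ext U X - zero_ext U Y"
  and zero_ext_add: "zero_ext U (X + Y) = zero_ext U X + zero_ext U Y"
  by (auto simp: zero_ext_def fun_eq_iff)

lemma zero_ext_id: "X \<in> sections \<A> U \<Longrightarrow> zero_ext U X = X"
  by (auto simp: zero_ext_def sections_def fun_eq_iff)

lemma sections_vfields: "X \<in> sections \<A> U \<Longrightarrow> X \<in> vfields \<A> U"
  by (simp add: sections_def)

context holomorphic_atlas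
begin

lemma zero_ext_vfields: "open U \<Longrightarrow> X \<in> vfields \<A> U \<Longrightarrow> zero_ext U X \<in> vfields \<A> U"
  by (rule vfields_cong[of U X]) simp_all

lemma zero_ext_sections: "open U \<Longrightarrow> X \<in> vfields \<A> U \<Longrightarrow> zero_ext U X \<in> sections \<A> U"
  unfolding sections_def using zero_ext_vfields by (simp add: zero_ext_def)

lemma local_operation_closed:
  "local_operation \<A> op \<Longrightarrow> open U \<Longrightarrow> X \<in> vfields \<A> U \<Longrightarrow> Y \<in> vfields \<A> U \<Longrightarrow> op X Y \<in> vfields \<A> U"
  unfolding local_operation_def by simp

lemma zero_ext_operation:
  assumes op: "local_operation \<A> op" and U: "open U" and X: "X \<in> vfields \<A> U" and Y: "Y \<in> vfields \<A> U"
  shows "zero_ext U (op (zero_ext U X) (zero_ext U Y)) = zero_ext U (op X Y)"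
proof -
  have "eq_on U (zero_ext U X) X" "eq_on U (zero_ext U Y) Y" by (simp_all add: eq_on_def)
  then have "eq_on U (op (zero_ext U X) (zero_ext U Y)) (op X Y)"
    using op U X Y zero_ext_vfields[OF U X] zero_ext_vfields[OF U Y] unfolding local_operation_def by simp
  then show ?thesis by (simp add: zero_ext_eq_iff)
qed

end

locale metric_multiplication =
  fixes \<A> :: "('m::{t2_space, second_countable_topology}, 'n::finite) chart set"
    and m :: "'m vfield \<Rightarrow> 'm vfield \<Rightarrow> 'm vfield"
    and e :: "'m vfield"
    and g :: "'m \<Rightarrow> 'm tvec \<Rightarrow> 'm tvec \<Rightarrow> complex"
    and D :: "'m vfield \<Rightarrow> 'm vfield \<Rightarrow> 'm vfield"
  assumes manifold: "connected_complex_manifold \<A>"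
    and mult: "tangent_multiplication \<A> m"
    and unit: "unit_field \<A> m e"
    and metric: "hol_metric \<A> g"
    and invariant: "mult_invariant \<A> m g"
    and lc: "levi_civita \<A> g D"
begin

sublocale holomorphic_atlas \<A>
  using manifold by unfold_locales (simp add: connected_complex_manifold_def)

lemma local_m: "local_operation \<A> m"
  using mult by (simp add: tangent_multiplication_def)

lemma local_D: "local_operation \<A> D"
  using lc by (simp add: levi_civita_def hol_connection_def)

lemma vfields_tangent: "X \<in> vfields \<A> U \<Longrightarrow> p \<in> U \<Longrightarrow> X p \<in> tangent_space \<A> p"
  by (simp add: vfields_def)

lemma g_sym: "u \<in> tangent_space \<A> p \<Longrightarrow> v \<in> tangent_space \<A> p \<Longrightarrow> g p u v = g p v u"
  using metric unfolding hol_metric_def by (elim conjE) simp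

lemma g_add:
  assumes u: "u \<in> tangent_space \<A> p" and v: "v \<in> tangent_space \<A> p" and w: "w \<in> tangent_space \<A> p"
  shows "g p (u + v) w = g p u w + g p v w"
proof -
  have "\<forall>p. \<forall>u\<in>tangent_space \<A> p. \<forall>v\<in>tangent_space \<A> p.
      (\<forall>w\<in>tangent_space \<A> p. g p (u + v) w = g p u w + g p v w) \<and>
      (\<forall>c. g p (\<lambda>f. c * u f) v = c * g p u v) \<and> g p u v = g p v u"
    using metric unfolding hol_metric_def by (rule conjunct1)
  from conjunct1[OF bspec[OF bspec[OF spec[OF this] u] v]] show ?thesis using w by (rule bspec)
qed

lemma g_diff:
  assumes "u \<in> tangent_space \<A> p" "v \<in> tangent_space \<A> p" "w \<in> tangent_space \<A> p"
  shows "g p w (u - v) = g p w u - g p w v"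
  using g_add[OF tangent_space_diff[OF assms(1,2)] assms(2,3)] g_sym[OF assms(3) tangent_space_diff[OF assms(1,2)]]
    g_sym[OF assms(3,1)] g_sym[OF assms(3,2)] by simp

lemma g_nondegenerate:
  "u \<in> tangent_space \<A> p \<Longrightarrow> (\<And>v. v \<in> tangent_space \<A> p \<Longrightarrow> g p u v = 0) \<Longrightarrow> u = 0"
  using metric unfolding hol_metric_def by (elim conjE) simp

lemma pair_fields_hol: "open U \<Longrightarrow> X \<in> vfields \<A> U \<Longrightarrow> Y \<in> vfields \<A> U \<Longrightarrow> pair_fields g X Y \<in> holfuns \<A> U"
  using metric unfolding hol_metric_def by (elim conjE) simp

lemma unit_vfields: "e \<in> vfields \<A> U"
  using vfields_subset[of e UNIV U] unit unfolding unit_field_def by simp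

context
  fixes U :: "'m set"
  assumes U: "open U"
begin

lemmas m_closed = local_operation_closed[OF local_m U]
  and D_closed = local_operation_closed[OF local_D U]

lemma m_commute: "X \<in> vfields \<A> U \<Longrightarrow> Y \<in> vfields \<A> U \<Longrightarrow> p \<in> U \<Longrightarrow> m X Y p = m Y X p"
  using mult U unfolding tangent_multiplication_def eq_on_def by blast

lemma m_assoc: "X \<in> vfields \<A> U \<Longrightarrow> Y \<in> vfields \<A> U \<Longrightarrow> Z \<in> vfields \<A> U \<Longrightarrow> p \<in> U \<Longrightarrow>
    m (m X Y) Z p = m X (m Y Z) p"
  using mult U unfolding tangent_multiplication_def eq_on_def by blast

lemma m_diff:
  assumes "X \<in> vfields \<A> U" "Y \<in> vfields \<A> U" "Z \<in> vfields \<A> U" "p \<in> U"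
  shows "m X (Y - Z) p = m X Y p - m X Z p"
proof -
  have "eq_on U (m X (Y - Z + Z)) (m X (Y - Z) + m X Z)"
    using mult U assms vfields_diff[OF assms(2,3)] holfuns_const[of 0 \<A> U]
    unfolding tangent_multiplication_def O_bilinear_def by blast
  then show ?thesis using assms by (simp add: eq_on_def)
qed

lemma m_unit: "X \<in> vfields \<A> U \<Longrightarrow> p \<in> U \<Longrightarrow> m e X p = X p"
  using unit U unfolding unit_field_def eq_on_def by blast

lemma bracket_eq:
  "X \<in> vfields \<A> U \<Longrightarrow> Y \<in> vfields \<A> U \<Longrightarrow> eq_on U (lie_bracket \<A> X Y) (D X Y - D Y X)"
  using lc U unfolding levi_civita_def eq_on_def by metis

lemma bracket_closed:
  "X \<in> vfields \<A> U \<Longrightarrow> Y \<in> vfields \<A> U \<Longrightarrow> lie_bracket \<A> X Y \<in> vfields \<A> U"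
  by (rule vfields_cong[OF U, of "D X Y - D Y X"])
     (use bracket_eq[of X Y] in \<open>simp_all add: eq_on_def vfields_diff D_closed\<close>)

lemma metric_compatible:
  "X \<in> vfields \<A> U \<Longrightarrow> Y \<in> vfields \<A> U \<Longrightarrow> Z \<in> vfields \<A> U \<Longrightarrow> p \<in> U \<Longrightarrow>
    X p (pair_fields g Y Z) = g p (D X Y p) (Z p) + g p (Y p) (D X Z p)"
  using lc U unfolding levi_civita_def eq_on_def deriv_along_def pair_fields_def plus_fun_def by blast

lemma g_mult:
  "X \<in> vfields \<A> U \<Longrightarrow> Y \<in> vfields \<A> U \<Longrightarrow> Z \<in> vfields \<A> U \<Longrightarrow> p \<in> U \<Longrightarrow>
    g p (X p) (m Y Z p) = g p (Y p) (m X Z p)"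
  using invariant[unfolded mult_invariant_def symmetric_tensor_3_iff] U
  by (simp add: tensor_A_def pair_fields_def)

abbreviation mU where "mU X Y \<equiv> zero_ext U (m X Y)"
abbreviation DU where "DU X Y \<equiv> zero_ext U (D X Y)"

lemma mU_ext: "X \<in> vfields \<A> U \<Longrightarrow> Y \<in> vfields \<A> U \<Longrightarrow> mU (zero_ext U X) (zero_ext U Y) = mU X Y"
  by (rule zero_ext_operation[OF local_m U])

lemma DU_ext: "X \<in> vfields \<A> U \<Longrightarrow> Y \<in> vfields \<A> U \<Longrightarrow> DU (zero_ext U X) (zero_ext U Y) = DU X Y"
  by (rule zero_ext_operation[OF local_D U])

interpretation product_with_connection "sections \<A> U" mU DU
proof
  fix X Y Z assume *: "X \<in> sections \<A> U" "Y \<in> sections \<A> U" "Z \<in> sections \<A> U"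
  note v = this[THEN sections_vfields]
  show "mU (mU X Y) Z = mU X (mU Y Z)"
  proof -
    have "mU (mU X Y) Z = mU (m X Y) Z" "mU X (mU Y Z) = mU X (m Y Z)"
      using mU_ext[OF m_closed[OF v(1,2)] v(3)] mU_ext[OF v(1) m_closed[OF v(2,3)]]
      by (simp_all add: zero_ext_id[OF *(1)] zero_ext_id[OF *(3)])
    then show ?thesis using m_assoc v by (simp add: zero_ext_eq_iff eq_on_def)
  qed
  show "mU X (Y - Z) = mU X Y - mU X Z"
    unfolding zero_ext_diff[symmetric] using m_diff v by (simp add: zero_ext_eq_iff eq_on_def)
next
  fix X Y assume *: "X \<in> sections \<A> U" "Y \<in> sections \<A> U"
  note v = this[THEN sections_vfields]
  show "X - Y \<in> sections \<A> U"
    using * vfields_diff by (simp add: sections_def)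
  show "mU X Y \<in> sections \<A> U" "DU X Y \<in> sections \<A> U"
    by (simp_all add: zero_ext_sections U m_closed D_closed v)
  show "mU X Y = mU Y X"
    using m_commute v by (simp add: zero_ext_eq_iff eq_on_def)
qed

lemma bracket_ext:
  "X \<in> vfields \<A> U \<Longrightarrow> Y \<in> vfields \<A> U \<Longrightarrow>
    bracket (zero_ext U X) (zero_ext U Y) = zero_ext U (lie_bracket \<A> X Y)"
  using bracket_eq[of X Y] by (simp add: bracket_def DU_ext zero_ext_diff[symmetric] zero_ext_eq_iff eq_on_def)

lemma cov_mult_ext:
  "X \<in> vfields \<A> U \<Longrightarrow> Y \<in> vfields \<A> U \<Longrightarrow> Z \<in> vfields \<A> U \<Longrightarrow>
    cov_mult (zero_ext U X) (zero_ext U Y) (zero_ext U Z) = zero_ext U (nabla_mult D m X Y Z)"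
  by (simp add: cov_mult_def nabla_mult_def DU_ext mU_ext m_closed D_closed zero_ext_diff)

lemma lie_mult_closed:
  "X \<in> vfields \<A> U \<Longrightarrow> Y \<in> vfields \<A> U \<Longrightarrow> Z \<in> vfields \<A> U \<Longrightarrow> lie_mult \<A> m X Y Z \<in> vfields \<A> U"
  by (simp add: lie_mult_def bracket_closed m_closed vfields_diff)

lemma lie_deriv_ext:
  "X \<in> vfields \<A> U \<Longrightarrow> Y \<in> vfields \<A> U \<Longrightarrow> Z \<in> vfields \<A> U \<Longrightarrow>
    lie_deriv (zero_ext U X) (zero_ext U Y) (zero_ext U Z) = zero_ext U (lie_mult \<A> m X Y Z)"
  by (simp add: lie_deriv_def lie_mult_def bracket_ext mU_ext m_closed bracket_closed zero_ext_diff)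

lemma F_defect_ext:
  assumes "X \<in> vfields \<A> U" "Y \<in> vfields \<A> U" "Z \<in> vfields \<A> U" "W \<in> vfields \<A> U"
  shows "F_defect (zero_ext U X) (zero_ext U Y) (zero_ext U Z) (zero_ext U W) = 0 \<longleftrightarrow>
    eq_on U (lie_mult \<A> m (m X Y) Z W) (m X (lie_mult \<A> m Y Z W) + m Y (lie_mult \<A> m X Z W))"
  using assms
  by (simp add: F_defect_def mU_ext lie_deriv_ext m_closed lie_mult_closed zero_ext_add[symmetric] zero_ext_eq_iff)

lemma metric_interpretation:
  assumes p: "p \<in> U"
  shows "metric_product_with_connection (sections \<A> U) mU DU (zero_ext U e) (\<lambda>X Y. g p (X p) (Y p))"
proof unfold_locales
  show "zero_ext U e \<in> sections \<A> U" by (rule zero_ext_sections[OF U unit_vfields])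
next
  fix X assume X: "X \<in> sections \<A> U"
  have "mU (zero_ext U e) X = mU e X"
    using mU_ext[OF unit_vfields sections_vfields[OF X]] by (simp add: zero_ext_id[OF X])
  also have "\<dots> = zero_ext U X"
    using m_unit[OF sections_vfields[OF X]] by (simp add: zero_ext_eq_iff eq_on_def)
  finally show "mU (zero_ext U e) X = X" by (simp add: zero_ext_id[OF X])
next
  fix X Y Z assume "X \<in> sections \<A> U" "Y \<in> sections \<A> U" "Z \<in> sections \<A> U"
  note v = this[THEN sections_vfields]
  show "g p (X p) ((Y - Z) p) = g p (X p) (Y p) - g p (X p) (Z p)"
    using g_diff[of "Y p" p "Z p" "X p"] v[THEN vfields_tangent, OF p] by simp
  show "g p (X p) (mU Y Z p) = g p (Y p) (mU X Z p)"
    using g_mult[OF v p] p by simp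
next
  fix X Y Z W assume "X \<in> sections \<A> U" "Y \<in> sections \<A> U" "Z \<in> sections \<A> U" "W \<in> sections \<A> U"
  note v = this[THEN sections_vfields]
  have near: "hol_near \<A> p (pair_fields g A (m B W))" if "A \<in> vfields \<A> U" "B \<in> vfields \<A> U" for A B
    unfolding hol_near_def using U p pair_fields_hol[OF U that(1) m_closed[OF that(2) v(4)]]
    by (intro exI[of _ U]) simp
  \<comment> \<open>The vector \<open>X p\<close> takes the same value on the two functions because they have the same germ at \<open>p\<close>.\<close>
  have "\<forall>\<^sub>F q in nhds p. pair_fields g Y (m Z W) q = pair_fields g Z (m Y W) q"
    unfolding eventually_nhds using U p g_mult[OF v(2,3,4)] by (intro exI[of _ U]) (simp add: pair_fields_def)
  from tangent_spaceD(2)[OF vfields_tangent[OF v(1) p] near[OF v(2,3)] near[OF v(3,2)] this]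
  have "g p (D X Y p) (m Z W p) + g p (Y p) (D X (m Z W) p) = g p (D X Z p) (m Y W p) + g p (Z p) (D X (m Y W) p)"
    by (simp add: metric_compatible v m_closed p)
  moreover have "DU X (mU A B) p = D X (m A B) p" if "A \<in> vfields \<A> U" "B \<in> vfields \<A> U" for A B
    using DU_ext[OF v(1) m_closed[OF that]] \<open>X \<in> sections \<A> U\<close> p by (metis zero_ext_apply zero_ext_id)
  ultimately show "g p (DU X Y p) (mU Z W p) + g p (Y p) (DU X (mU Z W) p)
      = g p (DU X Z p) (mU Y W p) + g p (Z p) (DU X (mU Y W) p)"
    using p v by simp
qed

lemma nabla_mult_closed:
  "X \<in> vfields \<A> U \<Longrightarrow> Y \<in> vfields \<A> U \<Longrightarrow> Z \<in> vfields \<A> U \<Longrightarrow> nabla_mult D m X Y Z \<in> vfields \<A> U"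
  by (simp add: nabla_mult_def m_closed D_closed vfields_diff)

text \<open>
  The derivative of the function \<open>g(Y, Z \<circ> W)\<close> is expanded by metric compatibility; its part \<open>g(\<nabla>\<^sub>X Y, Z \<circ> W)\<close> is
  subtracted in the definition of \<open>\<nabla>A\<close>.
\<close>
lemma nabla_A_eq:
  assumes v: "X \<in> vfields \<A> U" "Y \<in> vfields \<A> U" "Z \<in> vfields \<A> U" "W \<in> vfields \<A> U" and p: "p \<in> U"
  shows "nabla_A D m g X Y Z W p = g p (Y p) (nabla_mult D m X Z W p)"
proof -
  have t: "A p \<in> tangent_space \<A> p" if "A \<in> vfields \<A> U" for A using that p by (rule vfields_tangent)
  have "g p (Y p) (nabla_mult D m X Z W p) =
      g p (Y p) (D X (m Z W) p) - g p (Y p) (m (D X Z) W p) - g p (Y p) (m Z (D X W) p)"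
  proof -
    have "nabla_mult D m X Z W p = D X (m Z W) p - m (D X Z) W p - m Z (D X W) p"
      by (simp add: nabla_mult_def)
    moreover have "g p (Y p) (D X (m Z W) p - m (D X Z) W p - m Z (D X W) p) =
        g p (Y p) (D X (m Z W) p) - g p (Y p) (m (D X Z) W p) - g p (Y p) (m Z (D X W) p)"
      using v by (simp only: g_diff t m_closed D_closed tangent_space_diff)
    ultimately show ?thesis by (simp only:)
  qed
  then show ?thesis
    using v p by (simp add: nabla_A_def tensor_A_def deriv_along_def metric_compatible m_closed)
       (simp add: pair_fields_def)
qed

text \<open>
  Metric compatibility and vanishing torsion leave only the derivatives of \<open>e\<close>.
\<close>
lemma ext_deriv_coidentity:
  assumes v: "X \<in> vfields \<A> U" "Y \<in> vfields \<A> U" and p: "p \<in> U"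
  shows "ext_deriv \<A> (coidentity g e) X Y p = g p (Y p) (D X e p) - g p (X p) (D Y e p)"
proof -
  have t: "A p \<in> tangent_space \<A> p" if "A \<in> vfields \<A> U" for A using that p by (rule vfields_tangent)
  have "g p (lie_bracket \<A> X Y p) (e p) = g p (e p) (D X Y p - D Y X p)"
  proof -
    have "lie_bracket \<A> X Y p = D X Y p - D Y X p"
      using bracket_eq[OF v] p by (simp add: eq_on_def)
    with g_sym[OF t t, OF bracket_closed[OF v] unit_vfields] show ?thesis by (simp only:)
  qed
  also have "\<dots> = g p (D X Y p) (e p) - g p (D Y X p) (e p)"
    using g_diff[OF t t t, OF D_closed[OF v] D_closed[OF v(2,1)] unit_vfields]
      g_sym[OF t t, OF unit_vfields D_closed[OF v]] g_sym[OF t t, OF unit_vfields D_closed[OF v(2,1)]] by (simp only:)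
  finally show ?thesis
    using v p unit_vfields[of U]
    by (simp add: ext_deriv_def coidentity_def deriv_along_def metric_compatible) (simp add: pair_fields_def)
qed

lemma cov_mult_sections:
  assumes "X \<in> sections \<A> U" "Y \<in> sections \<A> U" "Z \<in> sections \<A> U"
  shows "cov_mult X Y Z = zero_ext U (nabla_mult D m X Y Z)"
  using cov_mult_ext[OF assms[THEN sections_vfields]] by (simp add: assms zero_ext_id[of _ \<A>])

lemma nabla_mult_commute:
  assumes v: "X \<in> vfields \<A> U" "Y \<in> vfields \<A> U" "Z \<in> vfields \<A> U" and p: "p \<in> U"
  shows "nabla_mult D m X Y Z p = nabla_mult D m X Z Y p"
  using cov_mult_commute[OF v[THEN zero_ext_sections[OF U]]] p by (simp add: cov_mult_ext v zero_ext_eq_iff eq_on_def)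

lemma nabla_A_swap:
  assumes v: "X \<in> vfields \<A> U" "Y \<in> vfields \<A> U" "Z \<in> vfields \<A> U" "W \<in> vfields \<A> U" and p: "p \<in> U"
  shows "nabla_A D m g X Y Z W p = nabla_A D m g X Z Y W p"
proof -
  interpret metric_product_with_connection "sections \<A> U" mU DU "zero_ext U e" "\<lambda>X Y. g p (X p) (Y p)"
    by (rule metric_interpretation[OF p])
  show ?thesis
    using B_cov_mult_swap[OF v[THEN zero_ext_sections[OF U]]] p by (simp add: cov_mult_ext v nabla_A_eq)
qed

lemma nabla_A_commute:
  assumes v: "X \<in> vfields \<A> U" "Y \<in> vfields \<A> U" "Z \<in> vfields \<A> U" "W \<in> vfields \<A> U" and p: "p \<in> U"
  shows "nabla_A D m g X Y Z W p = nabla_A D m g X Y W Z p"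
  using nabla_mult_commute[OF v(1,3,4) p] by (simp add: nabla_A_eq v p)

lemma F_identity_if_symmetric:
  assumes sym: "\<And>X Y Z p. X \<in> vfields \<A> U \<Longrightarrow> Y \<in> vfields \<A> U \<Longrightarrow> Z \<in> vfields \<A> U \<Longrightarrow> p \<in> U \<Longrightarrow>
      nabla_mult D m X Y Z p = nabla_mult D m Y X Z p"
    and v: "X \<in> vfields \<A> U" "Y \<in> vfields \<A> U" "Z \<in> vfields \<A> U" "W \<in> vfields \<A> U"
  shows "eq_on U (lie_mult \<A> m (m X Y) Z W) (m X (lie_mult \<A> m Y Z W) + m Y (lie_mult \<A> m X Z W))"
proof -
  have "cov_mult A B C = cov_mult B A C" if "A \<in> sections \<A> U" "B \<in> sections \<A> U" "C \<in> sections \<A> U" for A B C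
    using that sym by (simp add: cov_mult_sections zero_ext_eq_iff eq_on_def sections_vfields)
  from F_defect_eq_0[OF this v[THEN zero_ext_sections[OF U]]] show ?thesis
    by (simp add: F_defect_ext v)
qed

lemma coidentity_closed_if_symmetric:
  assumes sym: "\<And>X Y Z p. X \<in> vfields \<A> U \<Longrightarrow> Y \<in> vfields \<A> U \<Longrightarrow> Z \<in> vfields \<A> U \<Longrightarrow> p \<in> U \<Longrightarrow>
      nabla_mult D m X Y Z p = nabla_mult D m Y X Z p"
    and v: "X \<in> vfields \<A> U" "Y \<in> vfields \<A> U" and p: "p \<in> U"
  shows "ext_deriv \<A> (coidentity g e) X Y p = 0"
proof -
  interpret metric_product_with_connection "sections \<A> U" mU DU "zero_ext U e" "\<lambda>X Y. g p (X p) (Y p)"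
    by (rule metric_interpretation[OF p])
  have "cov_mult A B C = cov_mult B A C" if "A \<in> sections \<A> U" "B \<in> sections \<A> U" "C \<in> sections \<A> U" for A B C
    using that sym by (simp add: cov_mult_sections zero_ext_eq_iff eq_on_def sections_vfields)
  from coidentity_closed[OF this v[THEN zero_ext_sections[OF U]]] show ?thesis
    using v p unit_vfields[of U] by (simp add: DU_ext ext_deriv_coidentity)
qed

lemma nabla_A_symmetric_if_F_identity:
  assumes F: "\<And>X Y Z W. X \<in> vfields \<A> U \<Longrightarrow> Y \<in> vfields \<A> U \<Longrightarrow> Z \<in> vfields \<A> U \<Longrightarrow> W \<in> vfields \<A> U \<Longrightarrow>
      eq_on U (lie_mult \<A> m (m X Y) Z W) (m X (lie_mult \<A> m Y Z W) + m Y (lie_mult \<A> m X Z W))"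
    and cl: "\<And>X Y. X \<in> vfields \<A> U \<Longrightarrow> Y \<in> vfields \<A> U \<Longrightarrow> ext_deriv \<A> (coidentity g e) X Y p = 0"
    and v: "X \<in> vfields \<A> U" "Y \<in> vfields \<A> U" "Z \<in> vfields \<A> U" "W \<in> vfields \<A> U" and p: "p \<in> U"
  shows "nabla_A D m g X Y Z W p = nabla_A D m g Y X Z W p"
proof -
  interpret metric_product_with_connection "sections \<A> U" mU DU "zero_ext U e" "\<lambda>X Y. g p (X p) (Y p)"
    by (rule metric_interpretation[OF p])
  have "F_defect A B C E = 0"
    if s: "A \<in> sections \<A> U" "B \<in> sections \<A> U" "C \<in> sections \<A> U" "E \<in> sections \<A> U" for A B C E
    using F_defect_ext[OF s[THEN sections_vfields]] F[OF s[THEN sections_vfields]] s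
    by (simp add: zero_ext_id[of _ \<A>])
  moreover have "g p (A p) (DU B (zero_ext U e) p) = g p (B p) (DU A (zero_ext U e) p)"
    if s: "A \<in> sections \<A> U" "B \<in> sections \<A> U" for A B
  proof -
    note w = s[THEN sections_vfields]
    have "DU C (zero_ext U e) = DU C e" if "C \<in> sections \<A> U" for C
      using DU_ext[OF sections_vfields[OF that] unit_vfields] that by (simp add: zero_ext_id[of _ \<A>])
    then show ?thesis
      using cl[OF w(2,1)] s p by (simp add: ext_deriv_coidentity[OF w(2,1) p])
  qed
  ultimately show ?thesis
    using B_cov_mult_eq[OF _ _ v[THEN zero_ext_sections[OF U]]] p by (simp add: cov_mult_ext v nabla_A_eq)
qed

end

lemma eq_0_if_orthogonal_to_fields:
  assumes "u \<in> tangent_space \<A> p" "open U" "p \<in> U"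
    and orth: "\<And>V X. open V \<Longrightarrow> p \<in> V \<Longrightarrow> V \<subseteq> U \<Longrightarrow> X \<in> vfields \<A> V \<Longrightarrow> g p u (X p) = 0"
  shows "u = 0"
proof (rule g_nondegenerate[OF assms(1)])
  fix v assume "v \<in> tangent_space \<A> p"
  then obtain V X where "open V" "p \<in> V" "V \<subseteq> U" "X \<in> vfields \<A> V" "X p = v"
    by (rule tangent_vector_extends[OF _ assms(2,3)])
  with orth[of V X] show "g p u v = 0" by simp
qed

abbreviation "nabla_mult_symmetric \<equiv> symmetric_tensor \<A> 3 (\<lambda>X. nabla_mult D m (X 0) (X 1) (X 2))"
abbreviation "nabla_A_symmetric \<equiv> symmetric_tensor \<A> 4 (\<lambda>X. nabla_A D m g (X 0) (X 1) (X 2) (X 3))"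

lemma nabla_mult_symmetricD:
  "nabla_mult_symmetric \<Longrightarrow> open U \<Longrightarrow> X \<in> vfields \<A> U \<Longrightarrow> Y \<in> vfields \<A> U \<Longrightarrow> Z \<in> vfields \<A> U \<Longrightarrow> p \<in> U \<Longrightarrow>
    nabla_mult D m X Y Z p = nabla_mult D m Y X Z p"
  unfolding symmetric_tensor_3_iff by blast

lemma nabla_A_symmetricI:
  assumes "\<And>U X Y Z W p. open U \<Longrightarrow> X \<in> vfields \<A> U \<Longrightarrow> Y \<in> vfields \<A> U \<Longrightarrow> Z \<in> vfields \<A> U \<Longrightarrow>
      W \<in> vfields \<A> U \<Longrightarrow> p \<in> U \<Longrightarrow> nabla_A D m g X Y Z W p = nabla_A D m g Y X Z W p"
  shows nabla_A_symmetric
  unfolding symmetric_tensor_4_iff using assms nabla_A_swap nabla_A_commute by simp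

lemma nabla_A_symmetric_if_nabla_mult_symmetric:
  assumes nabla_mult_symmetric
  shows nabla_A_symmetric
proof (rule nabla_A_symmetricI)
  fix U X Y Z W p
  assume U: "open U" and v: "X \<in> vfields \<A> U" "Y \<in> vfields \<A> U" "Z \<in> vfields \<A> U" "W \<in> vfields \<A> U" and p: "p \<in> U"
  have "nabla_A D m g X Y Z W p = nabla_A D m g X Z Y W p"
    by (rule nabla_A_swap[OF U v p])
  also have "\<dots> = nabla_A D m g Y Z X W p"
    using nabla_mult_symmetricD[OF assms U v(1,2,4) p] by (simp add: nabla_A_eq[OF U] v p)
  also have "\<dots> = nabla_A D m g Y X Z W p"
    by (rule nabla_A_swap[OF U v(2,3,1,4) p])
  finally show "nabla_A D m g X Y Z W p = nabla_A D m g Y X Z W p" .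
qed

text \<open>
  The difference of the two values of \<open>\<nabla>\<circ>\<close> is orthogonal to all fields defined near the point, hence zero.
\<close>
lemma nabla_mult_symmetric_if_nabla_A_symmetric:
  assumes sym: nabla_A_symmetric
  shows nabla_mult_symmetric
  unfolding symmetric_tensor_3_iff
proof (intro allI impI ballI conjI)
  fix U X Y Z p
  assume U: "open U" and v: "X \<in> vfields \<A> U" "Y \<in> vfields \<A> U" "Z \<in> vfields \<A> U" and p: "p \<in> U"
  show "nabla_mult D m X Y Z p = nabla_mult D m X Z Y p"
    by (rule nabla_mult_commute[OF U v p])
  let ?u = "nabla_mult D m X Y Z p" and ?w = "nabla_mult D m Y X Z p"
  have u: "?u \<in> tangent_space \<A> p" "?w \<in> tangent_space \<A> p"
    using nabla_mult_closed[OF U] v vfields_tangent[OF _ p] by simp_all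
  have "?u - ?w = 0"
  proof (rule eq_0_if_orthogonal_to_fields[OF tangent_space_diff[OF u] U p])
    fix V W assume V: "open V" "p \<in> V" "V \<subseteq> U" and W: "W \<in> vfields \<A> V"
    note v' = v[THEN vfields_subset, OF V(3)]
    have "nabla_A D m g X W Y Z p = nabla_A D m g X Y W Z p"
      by (rule nabla_A_swap[OF V(1) v'(1) W v'(2,3) V(2)])
    also have "\<dots> = nabla_A D m g Y X W Z p"
      using sym V v' W unfolding symmetric_tensor_4_iff by blast
    also have "\<dots> = nabla_A D m g Y W X Z p"
      by (rule nabla_A_swap[OF V(1) v'(2,1) W v'(3) V(2)])
    finally have "g p (W p) ?u = g p (W p) ?w"
      by (simp add: nabla_A_eq[OF V(1)] v' W V(2))
    moreover have "W p \<in> tangent_space \<A> p" by (rule vfields_tangent[OF W V(2)])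
    ultimately show "g p (?u - ?w) (W p) = 0"
      using g_diff[OF u] g_sym[OF tangent_space_diff[OF u]] by simp
  qed
  then show "?u = ?w" by simp
qed

lemma F_manifold_if_nabla_mult_symmetric:
  assumes nabla_mult_symmetric
  shows "F_manifold \<A> m e \<and> closed_form \<A> (coidentity g e)"
  unfolding F_manifold_def closed_form_def
  using manifold mult unit F_identity_if_symmetric[OF _ nabla_mult_symmetricD[OF assms]]
    coidentity_closed_if_symmetric[OF _ nabla_mult_symmetricD[OF assms]]
  by (simp add: eq_on_def)

lemma nabla_A_symmetric_if_F_manifold:
  assumes "F_manifold \<A> m e" "closed_form \<A> (coidentity g e)"
  shows nabla_A_symmetric
proof (rule nabla_A_symmetricI)
  fix U X Y Z W p
  assume U: "open U" and v: "X \<in> vfields \<A> U" "Y \<in> vfields \<A> U" "Z \<in> vfields \<A> U" "W \<in> vfields \<A> U" and p: "p \<in> U"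
  show "nabla_A D m g X Y Z W p = nabla_A D m g Y X Z W p"
  proof (rule nabla_A_symmetric_if_F_identity[OF U _ _ v p])
    show "ext_deriv \<A> (coidentity g e) X Y p = 0" if "X \<in> vfields \<A> U" "Y \<in> vfields \<A> U" for X Y
      using assms(2) U that p unfolding closed_form_def eq_on_def by simp
  qed (use assms(1) U in \<open>unfold F_manifold_def, blast\<close>)
qed

end

section \<open>The equivalence\<close>

theorem theorem5p3:
  fixes \<A> :: "('m::{t2_space, second_countable_topology}, 'n::finite) chart set"
    and m :: "'m vfield \<Rightarrow> 'm vfield \<Rightarrow> 'm vfield"
    and e :: "'m vfield"
    and g :: "'m \<Rightarrow> 'm tvec \<Rightarrow> 'm tvec \<Rightarrow> complex"
    and D :: "'m vfield \<Rightarrow> 'm vfield \<Rightarrow> 'm vfield"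
  assumes "connected_complex_manifold \<A>"
    and "tangent_multiplication \<A> m"
    and "unit_field \<A> m e"
    and "hol_metric \<A> g"
    and "mult_invariant \<A> m g"
    and "levi_civita \<A> g D"
  shows "(F_manifold \<A> m e \<and> closed_form \<A> (coidentity g e)
            \<longleftrightarrow> symmetric_tensor \<A> 4 (\<lambda>X. nabla_A D m g (X 0) (X 1) (X 2) (X 3)))
       \<and> (symmetric_tensor \<A> 4 (\<lambda>X. nabla_A D m g (X 0) (X 1) (X 2) (X 3))
            \<longleftrightarrow> symmetric_tensor \<A> 3 (\<lambda>X. nabla_mult D m (X 0) (X 1) (X 2)))"
proof -
  interpret metric_multiplication \<A> m e g D
    by (rule metric_multiplication.intro[OF assms])
  show ?thesis
    using nabla_A_symmetric_if_nabla_mult_symmetric nabla_mult_symmetric_if_nabla_A_symmetric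
      F_manifold_if_nabla_mult_symmetric nabla_A_symmetric_if_F_manifold by blast
qed

end
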